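(* Let $\alpha>0$ and let $\{\psi_\delta\}_{\delta>0}\subset\mathrm{Ham}(X_\alpha)$ be the family of $\delta$-billiard maps of $X_\alpha$. For all $\varepsilon>0$ and $N\in\mathbb N$ there is $\delta>0$ such that $$\lambda(\mathcal T_{\psi_\delta,N})>1-\varepsilon.$$
   Context: Let $\omega_{S^2}$ be an area form on $S^2$ of total area $1$. For $\alpha>0$ let $X_\alpha=(S^2\times S^2,\omega_\alpha)$ with $\omega_\alpha=2(\alpha+1)\omega_{S^2}\oplus 2\alpha\,\omega_{S^2}$. In $S^2(a)=(S^2,a\omega_{S^2})$, $S^1_h$ ($|h|<\frac a2$) is the circle of constant height such that the annulus between the equator and $S^1_h$ has signed area $h$. Let $\square_\alpha=[-1-\alpha,1+\alpha]\times[-\alpha,\alpha]$ and, for $(x,y)\in\operatorname{int}\square_\alpha$, let $T(x,y)=S^1_x\times S^1_y\subset X_\alpha$. These are the fibres of the standard toric moment map $\mu:X_\alpha\to\square_\alpha$. Let $\lambda$ be Lebesgue measure on $\square_\alpha$ normalized by $\lambda(\square_\alpha)=1$. For $\phi\in\mathrm{Ham}(X_\alpha)$ and $N\in\mathbb N$, $$\mathcal T_{\phi,N}=\{(x,y)\in\operatorname{int}\square_\alpha : \phi^k(T(x,y))\cap T(x,y)=\varnothing\ \ \forall k\in\{1,\dots,N\}\}.$$ Construction of $\psi_\delta$ (for $\delta>0$ small). In $\square_\alpha$ let $S_1=\{y-x-1=0\}$, $S_2=\{y-x+1=0\}$, $S_3=\{y+x-1=0\}$, $S_4=\{y+x+1=0\}$,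 and let $S_i^\delta$ be the set of points of $\square_\alpha$ at integral affine distance $<\delta$ from $S_i$ (e.g. $S_1^\delta=\{|y-x-1|<\delta\}$). The complement of $S_1^\delta\cup S_2^\delta$ in $\square_\alpha$ has three components, denoted from left to right $U_5,U_1,U_3$; thus $U_5=\{y-x\ge1+\delta\}$, $U_1=\{|y-x|\le1-\delta\}$, $U_3=\{x-y\ge1+\delta\}$. The complement of $S_3^\delta\cup S_4^\delta$ has three components, denoted from left to right $U_6,U_4,U_2$; thus $U_6=\{x+y\le-1-\delta\}$, $U_4=\{|x+y|\le1-\delta\}$, $U_2=\{x+y\ge1+\delta\}$. Let $U_i^\delta$ be the set of points of $\square_\alpha$ at integral affine distance $<\delta$ from $U_i$. Model $M_1=Z\times S^2$, with $Z=\{(\theta,p)\in T^*S^1: -1<p<1\}$, symplectic form $d\theta\wedge dp\oplus2\alpha\omega_{S^2}$, and moment map $\nu_1(\theta,p,z)=(p,h(z))$, where $h:S^2\to[-\alpha,\alpha]$ is the height function generating the standard circle action on $(S^2,2\alpha\omega_{S^2})$. Let $R\in\mathrm{Ham}(S^2,2\alpha\omega_{S^2})$ with $h\circ R=-h$ (a suitable rotation). By cutting off in the $p$-direction, choose $\chi_1^\delta\in\mathrm{Ham}(M_1)$ with $\chi_1^\delta(\theta,p,z)=(\theta,p,R(z))$ for $-1+\delta<p<1-\delta$ and equal to the identity outside a slightly larger compact set. Model $M_2=\{\pi|z_1|^2+\pi|z_2|^2<2\alpha\}\subset\mathbb C^2$, the standard open ball, with moment map $\nu_2=(\pi|z_1|^2,\pi|z_2|^2)$.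 By a cut-off, choose $\chi_2^\delta\in\mathrm{Ham}(M_2)$ with $\chi_2^\delta(z_1,z_2)=(z_2,z_1)$ for $\pi|z_1|^2+\pi|z_2|^2\le2\alpha-\delta$ and equal to the identity outside a slightly larger compact set. Put $V_1=(-1+\delta,1-\delta)\times[-\alpha,\alpha]$ and $V_2=\{(u,v)\in\mathbb R_{\ge0}^2: u+v\le2\alpha-\delta\}$. For $i\in\{1,4\}$ set $j=1$; for $i\in\{2,3,5,6\}$ set $j=2$. The pair $(U_i^\delta,U_i)$ is integral affine equivalent to $(\operatorname{im}\nu_j,V_j)$, so there is a symplectic embedding $f_i:M_j\hookrightarrow X_\alpha$, equivariant for the $T^2$-actions (up to an automorphism of $T^2$), with image $\mu^{-1}(U_i^\delta)$ and mapping $\nu_j^{-1}(V_j)$ to $\mu^{-1}(U_i)$. Let $\varphi_i^\delta=f_i\circ\chi_j^\delta\circ f_i^{-1}$ on $\mu^{-1}(U_i^\delta)$, extended by the identity to an element of $\mathrm{Ham}(X_\alpha)$. The $\delta$-billiard map is $$\psi_\delta=\varphi_6^\delta\circ\varphi_5^\delta\circ\varphi_4^\delta\circ\varphi_3^\delta\circ\varphi_2^\delta\circ\varphi_1^\delta\in\mathrm{Ham}(X_\alpha).$$ *)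

theory Defs
  imports "HOL-Analysis.Analysis"
begin

section \<open>Smooth maps between embedded submanifolds\<close>

primrec C_k_on :: "nat \<Rightarrow> 'a::real_normed_vector set \<Rightarrow> ('a \<Rightarrow> 'b::real_normed_vector) \<Rightarrow> bool" where
  "C_k_on 0 U g \<longleftrightarrow> continuous_on U g"
| "C_k_on (Suc k) U g \<longleftrightarrow>
     (\<forall>x\<in>U. g differentiable (at x)) \<and>
     (\<forall>v. C_k_on k U (\<lambda>x. frechet_derivative g (at x) v))"

text \<open>Smoothness on an arbitrary subset of a Euclidean space: locally, the map is the restriction
  of a smooth map defined on an open subset of the ambient space.\<close>

definition smooth_map :: "'a::real_normed_vector set \<Rightarrow> ('a \<Rightarrow> 'b::real_normed_vector) \<Rightarrow> bool" where
  "smooth_map S f \<longleftrightarrow>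
     (\<forall>x\<in>S. \<exists>U g. open U \<and> x \<in> U \<and> (\<forall>k. C_k_on k U g) \<and> (\<forall>y\<in>U \<inter> S. g y = f y))"


section \<open>Symplectic submanifolds and Hamiltonian diffeomorphisms\<close>

text \<open>A symplectic manifold is represented by an embedded submanifold \<open>pts\<close> of a Euclidean space,
  its tangent spaces as linear subspaces of the ambient space, and its symplectic form (only the
  values on tangent vectors matter). Maps between such manifolds are total functions of the ambient
  types whose values outside \<open>pts\<close> are irrelevant.\<close>

record 'a symp =
  pts :: "'a set"
  tang :: "'a \<Rightarrow> 'a set"
  form :: "'a \<Rightarrow> 'a \<Rightarrow> 'a \<Rightarrow> real"

definition prod_symp :: "'a symp \<Rightarrow> 'b symp \<Rightarrow> ('a \<times> 'b) symp" (infixr "\<otimes>\<^sub>s" 70) where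
  "M \<otimes>\<^sub>s N =
     \<lparr> pts = pts M \<times> pts N,
       tang = (\<lambda>(x, y). tang M x \<times> tang N y),
       form = (\<lambda>(x, y) (u, u') (v, v'). form M x u v + form N y u' v') \<rparr>"

text \<open>The derivative of a function relative to \<open>pts M\<close> is determined only on tangent vectors, and
  only these values are used. Reversing the sign convention for the Hamiltonian vector field replaces
  a Hamiltonian by its negative, so it does not change the set \<open>Ham M\<close> below.\<close>

definition hamiltonian_vector :: "'a::real_normed_vector symp \<Rightarrow> ('a \<Rightarrow> real) \<Rightarrow> 'a \<Rightarrow> 'a \<Rightarrow> bool" where
  "hamiltonian_vector M H x X \<longleftrightarrow>
     X \<in> tang M x \<and>
     (\<exists>D. (H has_derivative D) (at x within pts M) \<and> (\<forall>v\<in>tang M x. form M x X v = D v))"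

text \<open>Time-one maps of smooth isotopies generated by smooth time-dependent Hamiltonians with compact
  support in the manifold (no restriction if the manifold is compact).\<close>

definition Ham :: "'a::real_normed_vector symp \<Rightarrow> ('a \<Rightarrow> 'a) set" where
  "Ham M = {\<phi>. \<exists>(H :: real \<Rightarrow> 'a \<Rightarrow> real) (\<Phi> :: real \<Rightarrow> 'a \<Rightarrow> 'a).
     smooth_map ({0..1} \<times> pts M) (\<lambda>(t, x). H t x) \<and>
     (\<exists>K. compact K \<and> K \<subseteq> pts M \<and> (\<forall>t\<in>{0..1}. \<forall>x\<in>pts M - K. H t x = 0)) \<and>
     smooth_map ({0..1} \<times> pts M) (\<lambda>(t, x). \<Phi> t x) \<and>
     (\<forall>x\<in>pts M. \<Phi> 0 x = x \<and> \<Phi> 1 x = \<phi> x \<and>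
        (\<forall>t\<in>{0..1}. \<Phi> t x \<in> pts M \<and>
           (\<exists>X. ((\<lambda>s. \<Phi> s x) has_vector_derivative X) (at t within {0..1}) \<and>
                hamiltonian_vector M (H t) (\<Phi> t x) X)))}"

text \<open>Smooth topological embeddings with \<open>f\<^sup>*\<omega>\<^sub>N = \<omega>\<^sub>M\<close>; the immersion property follows from the
  nondegeneracy of \<open>\<omega>\<^sub>M\<close>.\<close>

definition symplectic_embedding ::
  "'a::real_normed_vector symp \<Rightarrow> 'b::real_normed_vector symp \<Rightarrow> ('a \<Rightarrow> 'b) \<Rightarrow> bool" where
  "symplectic_embedding M N f \<longleftrightarrow>
     f ` pts M \<subseteq> pts N \<and> smooth_map (pts M) f \<and>
     (\<exists>g. homeomorphism (pts M) (f ` pts M) f g) \<and>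
     (\<forall>x\<in>pts M. \<exists>D. (f has_derivative D) (at x within pts M) \<and>
        (\<forall>u\<in>tang M x. \<forall>v\<in>tang M x. form N (f x) (D u) (D v) = form M x u v))"


section \<open>Spheres and the manifold \<open>X\<^sub>\<alpha> = (S\<^sup>2 \<times> S\<^sup>2, \<omega>\<^sub>\<alpha>)\<close>\<close>

text \<open>\<open>S2 a\<close> is \<open>(S\<^sup>2, a \<omega>)\<close>, where \<open>\<omega>\<close> is the round area form \<open>p \<bullet> (u \<times> v)\<close> divided by the
  total area \<open>4 * pi\<close> of the unit sphere.\<close>

definition S2 :: "real \<Rightarrow> (real^3) symp" where
  "S2 a = \<lparr> pts = sphere 0 1,
            tang = (\<lambda>p. {v. p \<bullet> v = 0}),
            form = (\<lambda>p u v. a * (1 / (4 * pi)) * (p \<bullet> cross3 u v)) \<rparr>"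

text \<open>By Archimedes' theorem the signed \<open>a \<omega>\<close>-area between the equator and the circle of points of
  \<open>S\<^sup>2\<close> with third coordinate \<open>c\<close> is \<open>a * c / 2\<close>. This function is also the moment map, with image
  \<open>[-a/2, a/2]\<close>, of the standard circle action on \<open>S2 a\<close> (period one).\<close>

definition height :: "real \<Rightarrow> real^3 \<Rightarrow> real" where
  "height a p = a * p $ 3 / 2"

definition circ :: "real \<Rightarrow> real \<Rightarrow> (real^3) set" where
  "circ a h = {p \<in> sphere 0 1. height a p = h}"

definition rot :: "real \<Rightarrow> real^3 \<Rightarrow> real^3" where
  "rot t p = vector [cos (2 * pi * t) * p $ 1 - sin (2 * pi * t) * p $ 2,
                     sin (2 * pi * t) * p $ 1 + cos (2 * pi * t) * p $ 2,
                     p $ 3]"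

type_synonym XT = "(real^3) \<times> (real^3)"

definition X_mfd :: "real \<Rightarrow> XT symp" where
  "X_mfd \<alpha> = S2 (2 * (\<alpha> + 1)) \<otimes>\<^sub>s S2 (2 * \<alpha>)"

definition \<mu> :: "real \<Rightarrow> XT \<Rightarrow> real \<times> real" where
  "\<mu> \<alpha> = (\<lambda>(p, q). (height (2 * (\<alpha> + 1)) p, height (2 * \<alpha>) q))"

definition act_X :: "real \<Rightarrow> real \<Rightarrow> XT \<Rightarrow> XT" where
  "act_X s t = (\<lambda>(p, q). (rot s p, rot t q))"

definition rect :: "real \<Rightarrow> (real \<times> real) set" where
  "rect \<alpha> = {- 1 - \<alpha>..1 + \<alpha>} \<times> {- \<alpha>..\<alpha>}"

definition torus :: "real \<Rightarrow> real \<times> real \<Rightarrow> XT set" where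
  "torus \<alpha> = (\<lambda>(x, y). circ (2 * (\<alpha> + 1)) x \<times> circ (2 * \<alpha>) y)"

definition lam :: "real \<Rightarrow> (real \<times> real) measure" where
  "lam \<alpha> = uniform_measure lebesgue (rect \<alpha>)"

definition \<T> :: "real \<Rightarrow> (XT \<Rightarrow> XT) \<Rightarrow> nat \<Rightarrow> (real \<times> real) set" where
  "\<T> \<alpha> \<phi> N = {q \<in> interior (rect \<alpha>). \<forall>k\<in>{1..N}. (\<phi> ^^ k) ` torus \<alpha> q \<inter> torus \<alpha> q = {}}"


section \<open>The two models\<close>

text \<open>\<open>S\<^sup>1 = \<real>/\<int>\<close> is the unit circle in \<open>\<complex>\<close> via \<open>w = cis (2 * pi * \<theta>)\<close>, so that
  \<open>d\<theta>(w') = Im (cnj w * w') / (2 * pi)\<close>.\<close>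

type_synonym M1T = "(complex \<times> real) \<times> (real^3)"

definition cyl :: "(complex \<times> real) symp" where
  "cyl = \<lparr> pts = sphere 0 1 \<times> {- 1<..<1},
         tang = (\<lambda>(w, p). {(w', p'). w \<bullet> w' = 0}),
         form = (\<lambda>(w, p) (u, a) (v, b).
            Im (cnj w * u) / (2 * pi) * b - Im (cnj w * v) / (2 * pi) * a) \<rparr>"

definition M1 :: "real \<Rightarrow> M1T symp" where
  "M1 \<alpha> = cyl \<otimes>\<^sub>s S2 (2 * \<alpha>)"

definition \<nu>1 :: "real \<Rightarrow> M1T \<Rightarrow> real \<times> real" where
  "\<nu>1 \<alpha> = (\<lambda>((w, p), z). (p, height (2 * \<alpha>) z))"

definition act_1 :: "real \<Rightarrow> real \<Rightarrow> M1T \<Rightarrow> M1T" where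
  "act_1 s t = (\<lambda>((w, p), z). ((cis (2 * pi * s) * w, p), rot t z))"

definition V1 :: "real \<Rightarrow> real \<Rightarrow> (real \<times> real) set" where
  "V1 \<alpha> \<delta> = {- 1 + \<delta><..<1 - \<delta>} \<times> {- \<alpha>..\<alpha>}"

type_synonym M2T = "complex \<times> complex"

definition \<nu>2 :: "M2T \<Rightarrow> real \<times> real" where
  "\<nu>2 = (\<lambda>(z1, z2). (pi * (cmod z1)\<^sup>2, pi * (cmod z2)\<^sup>2))"

text \<open>The form is the standard one, \<open>dx\<^sub>1 \<and> dy\<^sub>1 + dx\<^sub>2 \<and> dy\<^sub>2\<close>.\<close>

definition M2 :: "real \<Rightarrow> M2T symp" where
  "M2 \<alpha> = \<lparr> pts = {(z1, z2). pi * (cmod z1)\<^sup>2 + pi * (cmod z2)\<^sup>2 < 2 * \<alpha>},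
            tang = (\<lambda>_. UNIV),
            form = (\<lambda>_ (u1, u2) (v1, v2). Im (cnj u1 * v1) + Im (cnj u2 * v2)) \<rparr>"

definition act_2 :: "real \<Rightarrow> real \<Rightarrow> M2T \<Rightarrow> M2T" where
  "act_2 s t = (\<lambda>(z1, z2). (cis (2 * pi * s) * z1, cis (2 * pi * t) * z2))"

definition V2 :: "real \<Rightarrow> real \<Rightarrow> (real \<times> real) set" where
  "V2 \<alpha> \<delta> = {(u, v). 0 \<le> u \<and> 0 \<le> v \<and> u + v \<le> 2 * \<alpha> - \<delta>}"

definition is_chi1 :: "real \<Rightarrow> real \<Rightarrow> (real^3 \<Rightarrow> real^3) \<Rightarrow> (M1T \<Rightarrow> M1T) \<Rightarrow> bool" where
  "is_chi1 \<alpha> \<delta> R chi \<longleftrightarrow>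
     chi \<in> Ham (M1 \<alpha>) \<and>
     (\<forall>w p z. ((w, p), z) \<in> pts (M1 \<alpha>) \<longrightarrow> - 1 + \<delta> < p \<longrightarrow> p < 1 - \<delta> \<longrightarrow>
        chi ((w, p), z) = ((w, p), R z)) \<and>
     (\<exists>K. compact K \<and> {m \<in> pts (M1 \<alpha>). \<nu>1 \<alpha> m \<in> V1 \<alpha> \<delta>} \<subseteq> K \<and> K \<subseteq> pts (M1 \<alpha>) \<and>
        (\<forall>m\<in>pts (M1 \<alpha>) - K. chi m = m))"

definition is_chi2 :: "real \<Rightarrow> real \<Rightarrow> (M2T \<Rightarrow> M2T) \<Rightarrow> bool" where
  "is_chi2 \<alpha> \<delta> chi \<longleftrightarrow>
     chi \<in> Ham (M2 \<alpha>) \<and>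
     (\<forall>z1 z2. pi * (cmod z1)\<^sup>2 + pi * (cmod z2)\<^sup>2 \<le> 2 * \<alpha> - \<delta> \<longrightarrow> chi (z1, z2) = (z2, z1)) \<and>
     (\<exists>K. compact K \<and> {m \<in> pts (M2 \<alpha>). \<nu>2 m \<in> V2 \<alpha> \<delta>} \<subseteq> K \<and> K \<subseteq> pts (M2 \<alpha>) \<and>
        (\<forall>m\<in>pts (M2 \<alpha>) - K. chi m = m))"


section \<open>The regions of the rectangle\<close>

text \<open>The primitive integral covector whose level sets bound the \<open>i\<close>-th region.\<close>

definition covec :: "nat \<Rightarrow> real \<times> real \<Rightarrow> real" where
  "covec i = (\<lambda>(x, y). if odd i then y - x else y + x)"

text \<open>\<open>region \<alpha> \<delta> 5\<close>, \<open>region \<alpha> \<delta> 1\<close>, \<open>region \<alpha> \<delta> 3\<close> are the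
  components, from left to right, of the complement in the rectangle of the \<open>\<delta>\<close>-strips around \<open>y - x = 1\<close> and \<open>y - x = -1\<close>;
  \<open>region \<alpha> \<delta> 6\<close>, \<open>region \<alpha> \<delta> 4\<close>, \<open>region \<alpha> \<delta> 2\<close> are those for \<open>y + x = -1\<close> and \<open>y + x = 1\<close>.\<close>

definition region :: "real \<Rightarrow> real \<Rightarrow> nat \<Rightarrow> (real \<times> real) set" where
  "region \<alpha> \<delta> i = {(x, y) \<in> rect \<alpha>.
     (i = 5 \<and> y - x \<ge> 1 + \<delta>) \<or> (i = 1 \<and> \<bar>y - x\<bar> \<le> 1 - \<delta>) \<or> (i = 3 \<and> x - y \<ge> 1 + \<delta>) \<or>
     (i = 6 \<and> x + y \<le> - 1 - \<delta>) \<or> (i = 4 \<and> \<bar>x + y\<bar> \<le> 1 - \<delta>) \<or> (i = 2 \<and> x + y \<ge> 1 + \<delta>)}"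

text \<open>Points of the rectangle at integral affine distance less than \<open>\<delta>\<close> from \<open>region \<alpha> \<delta> i\<close>.\<close>

definition region_nbhd :: "real \<Rightarrow> real \<Rightarrow> nat \<Rightarrow> (real \<times> real) set" where
  "region_nbhd \<alpha> \<delta> i = {q \<in> rect \<alpha>. \<exists>r\<in>region \<alpha> \<delta> i. \<bar>covec i q - covec i r\<bar> < \<delta>}"


section \<open>Billiard maps\<close>

text \<open>Equivariance up to an automorphism of \<open>T\<^sup>2 = \<real>\<^sup>2/\<int>\<^sup>2\<close>, i.e. an element of \<open>GL(2, \<int>)\<close>.\<close>

definition equivariant_up_to_aut ::
  "'a set \<Rightarrow> (real \<Rightarrow> real \<Rightarrow> 'a \<Rightarrow> 'a) \<Rightarrow> (real \<Rightarrow> real \<Rightarrow> 'b \<Rightarrow> 'b) \<Rightarrow> ('a \<Rightarrow> 'b) \<Rightarrow> bool" where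
  "equivariant_up_to_aut S act act' f \<longleftrightarrow>
     (\<exists>a b c d :: int. \<bar>a * d - b * c\<bar> = 1 \<and>
        (\<forall>s t. \<forall>m\<in>S. f (act s t m) =
           act' (of_int a * s + of_int b * t) (of_int c * s + of_int d * t) (f m)))"

text \<open>The last condition is an inclusion because \<open>V1\<close> is open and the regions \<open>1\<close> and \<open>4\<close> are closed
  in the direction transverse to the walls.\<close>

definition is_chart ::
  "real \<Rightarrow> real \<Rightarrow> nat \<Rightarrow> 'a::real_normed_vector symp \<Rightarrow> (real \<Rightarrow> real \<Rightarrow> 'a \<Rightarrow> 'a) \<Rightarrow>
   ('a \<Rightarrow> real \<times> real) \<Rightarrow> (real \<times> real) set \<Rightarrow> ('a \<Rightarrow> XT) \<Rightarrow> bool" where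
  "is_chart \<alpha> \<delta> i M act \<nu> V f \<longleftrightarrow>
     symplectic_embedding M (X_mfd \<alpha>) f \<and>
     equivariant_up_to_aut (pts M) act act_X f \<and>
     f ` pts M = {m \<in> pts (X_mfd \<alpha>). \<mu> \<alpha> m \<in> region_nbhd \<alpha> \<delta> i} \<and>
     f ` {m \<in> pts M. \<nu> m \<in> V} \<subseteq> {m \<in> pts (X_mfd \<alpha>). \<mu> \<alpha> m \<in> region \<alpha> \<delta> i}"

definition transport :: "'a set \<Rightarrow> ('a \<Rightarrow> XT) \<Rightarrow> ('a \<Rightarrow> 'a) \<Rightarrow> XT \<Rightarrow> XT" where
  "transport S f chi x = (if x \<in> f ` S then f (chi (the_inv_into S f x)) else x)"

text \<open>\<open>\<psi>\<close> is a \<open>\<delta>\<close>-billiard map for some admissible choice of \<open>R\<close>, of the cut-off maps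
  and of the charts. Here \<open>f i\<close> is used for \<open>i \<in> {1, 4}\<close> and \<open>g i\<close> for \<open>i \<in> {2, 3, 5, 6}\<close>.\<close>

definition billiard_map :: "real \<Rightarrow> real \<Rightarrow> (XT \<Rightarrow> XT) \<Rightarrow> bool" where
  "billiard_map \<alpha> \<delta> \<psi> \<longleftrightarrow>
     (\<exists>R chi1 chi2 (f :: nat \<Rightarrow> M1T \<Rightarrow> XT) (g :: nat \<Rightarrow> M2T \<Rightarrow> XT).
        R \<in> Ham (S2 (2 * \<alpha>)) \<and>
        (\<forall>z\<in>pts (S2 (2 * \<alpha>)). height (2 * \<alpha>) (R z) = - height (2 * \<alpha>) z) \<and>
        is_chi1 \<alpha> \<delta> R chi1 \<and>
        is_chi2 \<alpha> \<delta> chi2 \<and>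
        (\<forall>i\<in>{1, 4}. is_chart \<alpha> \<delta> i (M1 \<alpha>) act_1 (\<nu>1 \<alpha>) (V1 \<alpha> \<delta>) (f i)) \<and>
        (\<forall>i\<in>{2, 3, 5, 6}. is_chart \<alpha> \<delta> i (M2 \<alpha>) act_2 \<nu>2 (V2 \<alpha> \<delta>) (g i)) \<and>
        (\<forall>x\<in>pts (X_mfd \<alpha>). \<psi> x =
           (transport (pts (M2 \<alpha>)) (g 6) chi2 \<circ> transport (pts (M2 \<alpha>)) (g 5) chi2 \<circ>
            transport (pts (M1 \<alpha>)) (f 4) chi1 \<circ> transport (pts (M2 \<alpha>)) (g 3) chi2 \<circ>
            transport (pts (M2 \<alpha>)) (g 2) chi2 \<circ> transport (pts (M1 \<alpha>)) (f 1) chi1) x))"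

end

theory Submission
  imports Defs "HOL-Probability.Probability_Measure"
begin

text \<open>In the coordinates \<open>d = x - y\<close>, \<open>s = x + y\<close>, the billiard map acts on the tori away
  from the strips by affine reflections: with \<open>m\<close> the truncation to \<open>[-1, 1]\<close>, the odd steps
  replace \<open>s\<close> by \<open>2 * m d - s\<close> and the even ones replace \<open>d\<close> by \<open>2 * m s - d\<close>.
  On tangent vectors \<open>(u, v)\<close>, the steps 1 and 4 act by \<open>v \<mapsto> 2 * u - v\<close> and
  \<open>u \<mapsto> 2 * v - u\<close>, the other steps by sign changes. (Projectively this is the reflection group of
  an ideal triangle.) Steps 1 and 4 strictly enlarge vectors in the cones \<open>|v| < |u|\<close> and
  \<open>|u| < |v|\<close> respectively and exchange these cones, and between two applications of step 1 there is exactly one of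
  step 4. Hence an orbit returning to its starting point with trivial derivative never uses these two steps;
  but then \<open>(- d, s)\<close> increases lexicographically in each round. If \<open>1, x, y\<close> are linearly
  independent over the rationals, then the orbit avoids all walls, and a return to the starting point forces
  the derivative to be trivial. So almost every torus does not return within \<open>N\<close> rounds
  once \<open>\<delta>\<close> is small, depending on the torus.

  That a chart carries the model moment map to an integral affine image of \<open>\<mu>\<close> follows from
  its symplecticity and equivariance; unimodularity and the shape of the regions leave only the
  expected reflections.\<close>

section \<open>Reflection dynamics\<close>

text \<open>An element \<open>(d, s, u, v)\<close> is a point with \<open>d = x - y\<close> and \<open>s = x + y\<close>, together with a
  tangent vector \<open>(u, v)\<close> in the same coordinates.\<close>

type_synonym tvec = "real \<times> real \<times> real \<times> real"

text \<open>In a strip, y changes sign while the covector bounding the strip is kept; in a corner,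
  the distances to the two sides meeting there are exchanged. Each active branch is one of these
  reflections written in \<open>d\<close> and \<open>s\<close>, together with its derivative on
  \<open>(u, v)\<close>.\<close>

definition step :: "nat \<Rightarrow> tvec \<Rightarrow> tvec" where
  "step i = (\<lambda>(d, s, u, v).
     if i = 1 \<and> \<bar>d\<bar> < 1 then (d, 2 * d - s, u, 2 * u - v)
     else if i = 2 \<and> s > 1 then (2 - d, s, - u, v)
     else if i = 3 \<and> d > 1 then (d, 2 - s, u, - v)
     else if i = 4 \<and> \<bar>s\<bar> < 1 then (2 * s - d, s, 2 * v - u, v)
     else if i = 5 \<and> d < - 1 then (d, - 2 - s, u, - v)
     else if i = 6 \<and> s < - 1 then (- 2 - d, s, - u, v)
     else (d, s, u, v))"

definition off_walls :: "real \<Rightarrow> tvec \<Rightarrow> bool" where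
  "off_walls \<delta> = (\<lambda>(d, s, u, v). \<bar>\<bar>d\<bar> - 1\<bar> > \<delta> \<and> \<bar>\<bar>s\<bar> - 1\<bar> > \<delta>)"

text \<open>Off the walls, the first of steps 1 and 4, if any, that acts on an orbit from the start
  of a round is step 4 for \<open>d < - 1\<close> and step 1 otherwise. The cone is the one in which
  this step enlarges vectors.\<close>

definition cone_at :: "tvec \<Rightarrow> bool" where
  "cone_at = (\<lambda>(d, s, u, v). if d < - 1 then u\<^sup>2 < v\<^sup>2 else v\<^sup>2 < u\<^sup>2)"

definition size_sq :: "tvec \<Rightarrow> real" where
  "size_sq = (\<lambda>(d, s, u, v). max (u\<^sup>2) (v\<^sup>2))"

text \<open>Lexicographic order on (\<open>size_sq\<close>, -d, s): the size registers the uses of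
  steps 1 and 4, and the position decides rounds without them.\<close>

definition grows :: "tvec \<Rightarrow> tvec \<Rightarrow> bool" where
  "grows z w \<longleftrightarrow> size_sq z < size_sq w \<or>
     size_sq z = size_sq w \<and> (fst w < fst z \<or> fst w = fst z \<and> fst (snd z) < fst (snd w))"

section \<open>One round of six reflections\<close>

lemma step_simps:
  "step 1 (d, s, u, v) = (if \<bar>d\<bar> < 1 then (d, 2 * d - s, u, 2 * u - v) else (d, s, u, v))"
  "step 2 (d, s, u, v) = (if 1 < s then (2 - d, s, - u, v) else (d, s, u, v))"
  "step 3 (d, s, u, v) = (if 1 < d then (d, 2 - s, u, - v) else (d, s, u, v))"
  "step 4 (d, s, u, v) = (if \<bar>s\<bar> < 1 then (2 * s - d, s, 2 * v - u, v) else (d, s, u, v))"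
  "step 5 (d, s, u, v) = (if d < - 1 then (d, - 2 - s, u, - v) else (d, s, u, v))"
  "step 6 (d, s, u, v) = (if s < - 1 then (- 2 - d, s, - u, v) else (d, s, u, v))"
  by (simp_all add: step_def)

lemma cone_at_iff: "cone_at (d, s, u, v) \<longleftrightarrow> (if d < - 1 then u\<^sup>2 < v\<^sup>2 else v\<^sup>2 < u\<^sup>2)"
  by (simp add: cone_at_def)

lemma size_sq_eq: "size_sq (d, s, u, v) = max (u\<^sup>2) (v\<^sup>2)"
  by (simp add: size_sq_def)

lemma grows_trans: "grows z w \<Longrightarrow> grows w y \<Longrightarrow> grows z y"
  unfolding grows_def by linarith

lemma grows_irrefl: "\<not> grows z z"
  by (simp add: grows_def)

text \<open>|2u - v| \<ge> 2|u| - |v| > |u|.\<close>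

lemma square_reflect_less:
  fixes u v :: real
  assumes "v\<^sup>2 < u\<^sup>2"
  shows "u\<^sup>2 < (2 * u - v)\<^sup>2"
proof -
  have "\<bar>v\<bar> < \<bar>u\<bar>" using assms abs_le_square_iff [of u v] by linarith
  then have "\<bar>u\<bar> < \<bar>2 * u - v\<bar>" by linarith
  then show ?thesis using abs_le_square_iff [of "2 * u - v" u] by linarith
qed

text \<open>Step 4 makes the new u dominate v. If it also pushes d below -1, then step 5 sends s
  below -1 and step 6 brings d back above -1, so in either case the endpoint asks for the cone |v| <
  |u|.\<close>

lemma later_steps_inner:
  fixes d s u v :: real
  assumes "\<bar>s\<bar> < 1" "u\<^sup>2 < v\<^sup>2"
  defines "w \<equiv> step 6 (step 5 (step 4 (d, s, u, v)))"
  shows "cone_at w" "size_sq (d, s, u, v) < size_sq w"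
proof -
  define d' u' where "d' = 2 * s - d" and "u' = 2 * v - u"
  have less: "v\<^sup>2 < u'\<^sup>2" unfolding u'_def using square_reflect_less assms by auto
  have 4: "step 4 (d, s, u, v) = (d', s, u', v)"
    using assms by (simp add: step_simps d'_def u'_def)
  have "w = (if d' < - 1 then (- 2 - d', - 2 - s, - u', - v) else (d', s, u', v))"
    unfolding w_def 4 using assms(1) by (auto simp: step_simps)
  then show "cone_at w" "size_sq (d, s, u, v) < size_sq w"
    using less assms(2) by (simp_all add: cone_at_iff size_sq_eq max_def)
qed

text \<open>Step 4 is idle. If step 5 acts, it moves s to -2 - s > -1 and so makes step 6 idle;
  otherwise step 6 acts.\<close>

lemma later_steps_outer:
  assumes "s < - 1"
  shows "step 6 (step 5 (step 4 (d, s, u, v))) =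
    (if d < - 1 then (d, - 2 - s, u, - v) else (- 2 - d, s, - u, v))"
  using assms by (simp add: step_simps)

text \<open>Split by the initial d. For |d| < 1, step 1 enlarges v and hands the vector to the cone
  of step 4; for d < -1 it lies in that cone already; for d > 1 neither strip step acts in this
  round. The wall hypotheses turn negated strict inequalities for d and s into strict ones.\<close>

lemma round_grows:
  assumes "cone_at z0" "off_walls 0 z0" "off_walls 0 (step 1 z0)"
    "off_walls 0 (step 3 (step 2 (step 1 z0)))"
  defines "w \<equiv> step 6 (step 5 (step 4 (step 3 (step 2 (step 1 z0)))))"
  shows "cone_at w \<and> grows z0 w"
proof -
  obtain d s u v where z0: "z0 = (d, s, u, v)" by (cases z0)
  have s: "\<bar>d\<bar> \<noteq> 1" "\<bar>s\<bar> \<noteq> 1" using assms(2) unfolding z0 by (auto simp: off_walls_def)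
  \<comment> \<open>The rest of the round on a vector in the cone |u| < |v|: either step 4 enlarges
    it, or \<open>s' < - 1\<close> and the endpoint is explicit, so that positions can be
    compared.\<close>
  have later: "cone_at w \<and> (size_sq z < size_sq w \<or>
      s' < - 1 \<and> w = (if d' < - 1 then (d', - 2 - s', u', - v') else (- 2 - d', s', - u', v')))"
    if z: "step 3 (step 2 (step 1 z0)) = z" "z = (d', s', u', v')" and "u'\<^sup>2 < v'\<^sup>2" "s' < 1" for z d' s' u' v'
  proof -
    have "s' \<noteq> - 1" "d' \<noteq> - 1" using assms(4) z by (auto simp: off_walls_def)
    then consider "\<bar>s'\<bar> < 1" | "s' < - 1" using \<open>s' < 1\<close> by linarith
    then show ?thesis
    proof cases
      case 1
      then show ?thesis using later_steps_inner [of s' u' v' d'] that unfolding w_def by auto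
    next
      case 2
      then show ?thesis using later_steps_outer [of s' d' u' v'] that \<open>d' \<noteq> - 1\<close> unfolding w_def
        by (auto simp: cone_at_iff)
    qed
  qed
  consider "\<bar>d\<bar> < 1" | "1 < d" | "d < - 1" using s by linarith
  then show "cone_at w \<and> grows z0 w"
  proof cases
    case 1
    define s1 v1 where "s1 = 2 * d - s" and "v1 = 2 * u - v"
    have "v\<^sup>2 < u\<^sup>2" using 1 \<open>cone_at z0\<close> unfolding z0 cone_at_iff by auto
    then have less: "u\<^sup>2 < v1\<^sup>2" "size_sq z0 < v1\<^sup>2"
      using square_reflect_less [of v u] unfolding v1_def z0 size_sq_eq by auto
    have z1: "step 1 z0 = (d, s1, u, v1)" using 1 unfolding z0 s1_def v1_def step_simps by simp
    have s1: "\<bar>s1\<bar> \<noteq> 1" using assms(3) unfolding z1 by (auto simp: off_walls_def)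
    show ?thesis
    proof (cases "1 < s1")
      case True
      then have "step 3 (step 2 (step 1 z0)) = (2 - d, 2 - s1, - u, - v1)"
        using 1 unfolding z1 step_simps by (simp add: step_simps)
      from later [OF this refl] show ?thesis
        using True less 1 by (auto simp: grows_def size_sq_eq split: if_splits)
    next
      case False
      then have "step 3 (step 2 (step 1 z0)) = (d, s1, u, v1)"
        using 1 unfolding z1 step_simps by (simp add: step_simps)
      from later [OF this refl] show ?thesis
        using False less 1 s1 by (auto simp: grows_def size_sq_eq split: if_splits)
    qed
  next
    case 2
    then have less: "v\<^sup>2 < u\<^sup>2" using \<open>cone_at z0\<close> unfolding z0 cone_at_iff by auto
    have z1: "step 1 z0 = z0" using 2 unfolding z0 step_simps by simp
    show ?thesis
    proof (cases "1 < s")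
      case True
      \<comment> \<open>Step 2 moves d to 2 - d < 1, so step 3 is idle; for d > 3 steps 5 and 6 act
        as well. In both cases d decreases.\<close>
      then have "w = (if d > 3 then (d - 4, - 2 - s, u, - v) else (2 - d, s, - u, v))"
        using 2 unfolding w_def z1 unfolding z0 by (simp add: step_simps)
      then show ?thesis using True less 2 unfolding z0
        by (auto simp: cone_at_iff grows_def size_sq_eq)
    next
      case False
      \<comment> \<open>Only step 3 acts: d is kept and s < 1 grows to 2 - s.\<close>
      then have "w = (d, 2 - s, u, - v)"
        using 2 s unfolding w_def z1 unfolding z0 by (simp add: step_simps)
      then show ?thesis using False less 2 s unfolding z0
        by (auto simp: cone_at_iff grows_def size_sq_eq)
    qed
  next
    case 3
    then have less: "u\<^sup>2 < v\<^sup>2" using \<open>cone_at z0\<close> unfolding z0 cone_at_iff by auto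
    have z1: "step 1 z0 = z0" using 3 unfolding z0 step_simps by simp
    show ?thesis
    proof (cases "1 < s")
      case True
      then have "step 3 (step 2 (step 1 z0)) = (2 - d, 2 - s, - u, - v)"
        using 3 unfolding z1 unfolding z0 by (simp add: step_simps)
      from later [OF this refl] show ?thesis
        using True less 3 unfolding z0 by (auto simp: grows_def size_sq_eq split: if_splits)
    next
      case False
      then have "step 3 (step 2 (step 1 z0)) = (d, s, u, v)"
        using 3 unfolding z1 unfolding z0 by (simp add: step_simps)
      from later [OF this refl] show ?thesis
        using False less 3 s unfolding z0 by (auto simp: grows_def size_sq_eq split: if_splits)
    qed
  qed
qed

section \<open>Orbits and the integral affine maps along them\<close>

primrec run :: "nat \<Rightarrow> tvec \<Rightarrow> tvec" where
  "run 0 z = z"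
| "run (Suc n) z = step (n mod 6 + 1) (run n z)"

text \<open>Linear independence of 1, a, b over the rationals; \<open>l = 0\<close> follows once
  \<open>m = 0\<close> and \<open>n = 0\<close>.\<close>

definition independent_over_int :: "real \<Rightarrow> real \<Rightarrow> bool" where
  "independent_over_int a b \<longleftrightarrow>
     (\<forall>m n l :: int. of_int m * a + of_int n * b + of_int l = 0 \<longrightarrow> m = 0 \<and> n = 0)"

text \<open>The affine map with matrix \<open>(m, n; k, l)\<close> carries \<open>(a, b)\<close> to \<open>(d, s)\<close>, and its linear part carries
  \<open>(e, f)\<close> to \<open>(u, v)\<close>.\<close>

definition tracks :: "real \<times> real \<Rightarrow> real \<times> real \<Rightarrow> tvec \<Rightarrow> bool" where
  "tracks = (\<lambda>(a, b) (e, f) (d, s, u, v). \<exists>m n k l p q :: int.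
     d = of_int m * a + of_int n * b + of_int p \<and> s = of_int k * a + of_int l * b + of_int q \<and>
     u = of_int m * e + of_int n * f \<and> v = of_int k * e + of_int l * f \<and>
     \<bar>m * l - n * k\<bar> = 1)"

lemma tracksI:
  assumes "d = of_int m * a + of_int n * b + of_int p" "s = of_int k * a + of_int l * b + of_int q"
    "u = of_int m * e + of_int n * f" "v = of_int k * e + of_int l * f" "\<bar>m * l - n * k\<bar> = 1"
  shows "tracks (a, b) (e, f) (d, s, u, v)"
  unfolding tracks_def prod.case using assms by blast

lemma tracksE:
  assumes "tracks (a, b) (e, f) (d, s, u, v)"
  obtains m n k l p q :: int where
    "d = of_int m * a + of_int n * b + of_int p" "s = of_int k * a + of_int l * b + of_int q"
    "u = of_int m * e + of_int n * f" "v = of_int k * e + of_int l * f" "\<bar>m * l - n * k\<bar> = 1"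
  using assms unfolding tracks_def prod.case by blast

text \<open>Exchanging the rows reverses the determinant, which is why \<open>tracks\<close> fixes
  only its absolute value.\<close>

lemma tracks_swap:
  assumes "tracks (a, b) (e, f) (d, s, u, v)"
  shows "tracks (a, b) (e, f) (s, d, v, u)"
proof -
  from assms obtain m n k l p q :: int where h:
    "d = of_int m * a + of_int n * b + of_int p" "s = of_int k * a + of_int l * b + of_int q"
    "u = of_int m * e + of_int n * f" "v = of_int k * e + of_int l * f" "\<bar>m * l - n * k\<bar> = 1"
    by (rule tracksE)
  have "k * n - l * m = - (m * l - n * k)" by (simp add: mult.commute)
  then have "\<bar>k * n - l * m\<bar> = 1" using h(5) by linarith
  then show ?thesis using h by (intro tracksI)
qed

text \<open>The second row becomes j times the first minus itself, an integral row operation of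
  determinant -1. Up to exchanging the coordinates, the active branches of \<open>step\<close> have
  this form, with (c, j) = (0, 2) in the strips and (2, 0) or (-2, 0) in the corners.\<close>

lemma tracks_reflect:
  assumes "tracks (a, b) (e, f) (d, s, u, v)"
  shows "tracks (a, b) (e, f) (d, of_int c + of_int j * d - s, u, of_int j * u - v)"
proof -
  from assms obtain m n k l p q :: int where h:
    "d = of_int m * a + of_int n * b + of_int p" "s = of_int k * a + of_int l * b + of_int q"
    "u = of_int m * e + of_int n * f" "v = of_int k * e + of_int l * f" "\<bar>m * l - n * k\<bar> = 1"
    by (rule tracksE)
  have "m * (j * n - l) - n * (j * m - k) = - (m * l - n * k)"
    by (simp add: algebra_simps)
  then have "\<bar>m * (j * n - l) - n * (j * m - k)\<bar> = 1" using h(5) by linarith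
  moreover have "of_int c + of_int j * d - s
      = of_int (j * m - k) * a + of_int (j * n - l) * b + of_int (j * p - q + c)"
    unfolding h(1,2) by (simp add: algebra_simps)
  moreover have "of_int j * u - v = of_int (j * m - k) * e + of_int (j * n - l) * f"
    unfolding h(3,4) by (simp add: algebra_simps)
  ultimately show ?thesis using h(1,3) by (intro tracksI)
qed

lemma tracks_step:
  assumes "tracks (a, b) (e, f) z"
  shows "tracks (a, b) (e, f) (step i z)"
proof -
  obtain d s u v where z: "z = (d, s, u, v)" by (cases z)
  have 1: "tracks (a, b) (e, f) (d, of_int c + of_int j * d - s, u, of_int j * u - v)" for j c
    using tracks_reflect assms z by auto
  have 2: "tracks (a, b) (e, f) (of_int c + of_int j * s - d, s, of_int j * v - u, v)" for j c
    using tracks_swap [OF tracks_reflect [OF tracks_swap]] assms z by simp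
  show ?thesis
    using 1 [of 0 2] 1 [of 2 0] 1 [of "- 2" 0] 2 [of 0 2] 2 [of 2 0] 2 [of "- 2" 0] assms
    unfolding z step_def by simp
qed

lemma tracks_run: "tracks (a, b) (e, f) z \<Longrightarrow> tracks (a, b) (e, f) (run n z)"
  by (induction n) (auto intro: tracks_step)

lemma tracks_start: "tracks (d, s) (u, v) (d, s, u, v)"
  by (rule tracksI [of _ 1 _ 0 _ 0 _ 0 1 0]) auto

lemma independent_over_intD:
  assumes "independent_over_int a b"
    and "of_int m * a + of_int n * b + of_int p = of_int m' * a + of_int n' * b + of_int p'"
  shows "m = m'" "n = n'"
proof -
  have "of_int (m - m') * a + of_int (n - n') * b + of_int (p - p') = 0"
    using assms(2) by (simp add: algebra_simps)
  then have "m - m' = 0 \<and> n - n' = 0"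
    using assms(1) unfolding independent_over_int_def by blast
  then show "m = m'" "n = n'" by auto
qed

text \<open>Unimodularity makes both rows nonzero, so by independence neither d nor s can take an
  integral value, in particular not 1 or -1.\<close>

lemma tracks_off_walls:
  assumes "independent_over_int a b" "tracks (a, b) (e, f) z"
  shows "off_walls 0 z"
proof -
  obtain d s u v where z: "z = (d, s, u, v)" by (cases z)
  from assms(2) obtain m n k l p q :: int where h:
    "d = of_int m * a + of_int n * b + of_int p" "s = of_int k * a + of_int l * b + of_int q"
    "\<bar>m * l - n * k\<bar> = 1"
    unfolding z by (rule tracksE)
  have "\<bar>of_int m * a + of_int n * b + of_int p\<bar> \<noteq> 1" if "m \<noteq> 0 \<or> n \<noteq> 0" for m n p :: int
    using independent_over_intD [OF assms(1), of m n p 0 0 1]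
      independent_over_intD [OF assms(1), of m n p 0 0 "- 1"] that by (auto simp: abs_eq_iff')
  moreover have "m \<noteq> 0 \<or> n \<noteq> 0" "k \<noteq> 0 \<or> l \<noteq> 0" using h(3) by auto
  ultimately show ?thesis unfolding z h(1,2) off_walls_def by auto
qed

section \<open>Impossibility of a return\<close>

lemma run_step: "i = j + 1 \<Longrightarrow> j < 6 \<Longrightarrow> run (6 * k + i) z = step i (run (6 * k + j) z)"
  by simp

lemma run_round:
  "run (6 * Suc k) z = step 6 (step 5 (step 4 (step 3 (step 2 (step 1 (run (6 * k) z))))))"
proof -
  have "run (6 * Suc k) z = run (6 * k + 6) z"
    by (simp add: algebra_simps)
  then show ?thesis
    using run_step [of 6 5] run_step [of 5 4] run_step [of 4 3] run_step [of 3 2] run_step [of 2 1]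
      run_step [of 1 0]
    by (simp del: run.simps add: numeral_eq_Suc)
qed

text \<open>Supplies a tangent vector in the cone that \<open>cone_at\<close> demands at the
  point.\<close>

definition start_vec :: "real \<times> real \<Rightarrow> tvec" where
  "start_vec = (\<lambda>(d, s). (d, s, if d < - 1 then (0, 1) else (1, 0)))"

text \<open>Every round moves strictly up in the order \<open>grows\<close>. At a return, comparing
  coefficients forces the tracked matrix to be the identity, so the tangent vector returns too and
  the order would relate an element to itself.\<close>

lemma no_return:
  assumes ind: "independent_over_int d s" and "k > 0"
    and run: "run (6 * k) (start_vec (d, s)) = (d, s, w)"
  shows False
proof -
  obtain e f where ef: "start_vec (d, s) = (d, s, e, f)" and "(e, f) = (if d < - 1 then (0, 1) else (1, 0))"
    by (cases "d < - 1") (auto simp: start_vec_def)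
  then have cone: "cone_at (d, s, e, f)" by (auto simp: cone_at_iff split: if_splits)
  have tr: "tracks (d, s) (e, f) (run n (d, s, e, f))" for n
    by (intro tracks_run tracks_start)
  have round: "cone_at (run (6 * Suc k) (d, s, e, f)) \<and> grows (run (6 * k) (d, s, e, f)) (run (6 * Suc k) (d, s, e, f))"
    if "cone_at (run (6 * k) (d, s, e, f))" for k
    unfolding run_round
    by (intro round_grows that tracks_off_walls [OF ind, of e f] tracks_step tr)
  have "cone_at (run (6 * Suc k) (d, s, e, f)) \<and> grows (d, s, e, f) (run (6 * Suc k) (d, s, e, f))" for k
  proof (induction k)
    case 0
    then show ?case using round [of 0] cone by simp
  next
    case (Suc k)
    then show ?case using round [of "Suc k"] grows_trans by blast
  qed
  then have "grows (d, s, e, f) (d, s, w)"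
    using \<open>k > 0\<close> run ef by (metis gr0_conv_Suc)
  moreover have "w = (e, f)"
  proof -
    obtain u v where w: "w = (u, v)" by (cases w)
    obtain m n k l p q :: int where
      h: "d = of_int m * d + of_int n * s + of_int p" "s = of_int k * d + of_int l * s + of_int q"
      "u = of_int m * e + of_int n * f" "v = of_int k * e + of_int l * f"
      using tr [of "6 * k"] run unfolding ef w by (metis tracksE)
    have "m = 1" "n = 0" "k = 0" "l = 1"
      using independent_over_intD [OF ind, of 1 0 0 m n p] independent_over_intD [OF ind, of 0 1 0 k l q] h
      by auto
    then show ?thesis using h w by simp
  qed
  ultimately show False using grows_irrefl by simp
qed

section \<open>Moment maps under charts\<close>

definition rot_gen :: "real^3 \<Rightarrow> real^3" where
  "rot_gen p = vector [- p $ 2, p $ 1, 0]"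

lemma rot_0 [simp]: "rot 0 p = p"
  by (simp add: rot_def vec_eq_iff forall_3)

lemma rot_has_vector_derivative:
  "((\<lambda>t. rot (c * t) p) has_vector_derivative (2 * pi * c) *\<^sub>R rot_gen p) (at 0)"
proof -
  have eq: "rot (c * t) p = cos (2 * pi * c * t) *\<^sub>R vector [p $ 1, p $ 2, 0]
      + sin (2 * pi * c * t) *\<^sub>R rot_gen p + vector [0, 0, p $ 3]" for t
    by (simp add: rot_def rot_gen_def vec_eq_iff forall_3 mult.assoc)
  show ?thesis
    unfolding eq by (auto intro!: derivative_eq_intros simp: has_vector_derivative_def)
qed

text \<open>The triple product equals |p|^2 times the third coordinate of w, minus the third
  coordinate of p times the inner product of p and w. On tangent vectors of the unit sphere this
  makes the third coordinate a Hamiltonian for the rotation.\<close>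

lemma form_rot_gen:
  fixes p w :: "real^3"
  assumes "norm p = 1" "p \<bullet> w = 0"
  shows "p \<bullet> cross3 (rot_gen p) w = w $ 3"
proof -
  have "p \<bullet> cross3 (rot_gen p) w = (p \<bullet> p) * w $ 3 - p $ 3 * (p \<bullet> w)"
    by (simp add: cross3_def rot_gen_def inner_vec_def sum_3 algebra_simps)
  then show ?thesis using assms by (simp add: dot_square_norm)
qed

lemma inner_rot_gen: "p \<bullet> rot_gen p = 0"
  by (simp add: rot_gen_def inner_vec_def sum_3)

lemma height_rot [simp]: "height a (rot t p) = height a p"
  by (simp add: height_def rot_def)

lemma \<mu>_act_X [simp]: "\<mu> \<alpha> (act_X s t m) = \<mu> \<alpha> m"
  by (cases m) (simp add: \<mu>_def act_X_def)

lemma sphere_velocity_tangent: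
  fixes \<gamma> :: "real \<Rightarrow> 'a::real_inner"
  assumes "(\<gamma> has_vector_derivative v) (at t within {0..1})" "t \<in> {0..1}"
    and "\<And>t. t \<in> {0..1} \<Longrightarrow> norm (\<gamma> t) = 1"
  shows "\<gamma> t \<bullet> v = 0"
proof -
  have "((\<lambda>t. \<gamma> t \<bullet> \<gamma> t) has_vector_derivative (\<gamma> t \<bullet> v + v \<bullet> \<gamma> t)) (at t within {0..1})"
    by (rule bounded_bilinear.has_vector_derivative [OF bounded_bilinear_inner assms(1) assms(1)])
  moreover have "((\<lambda>t. \<gamma> t \<bullet> \<gamma> t) has_vector_derivative 0) (at t within {0..1})"
    by (rule has_vector_derivative_transform [of t "{0..1}" _ "\<lambda>_. 1"])
      (use assms in \<open>auto simp: dot_square_norm\<close>)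
  ultimately have "\<gamma> t \<bullet> v + v \<bullet> \<gamma> t = 0"
    using vector_derivative_unique_within [of t "{0..1}"] assms(2)
    by (metis at_within_Icc_at_left trivial_limit_at_left_real trivial_limit_at_right_real at_within_cbox_finite box_real islimpt_Icc trivial_limit_within zero_less_one)
  then show ?thesis by (simp add: inner_commute)
qed

definition X_gen :: "real \<Rightarrow> real \<Rightarrow> XT \<Rightarrow> XT" where
  "X_gen a c = (\<lambda>(p, q). ((2 * pi * a) *\<^sub>R rot_gen p, (2 * pi * c) *\<^sub>R rot_gen q))"

lemma act_X_has_vector_derivative:
  "((\<lambda>t. act_X (a * t) (c * t) m) has_vector_derivative X_gen a c m) (at 0)"
  by (cases m) (auto simp: act_X_def X_gen_def intro!: has_vector_derivative_Pair rot_has_vector_derivative)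

lemma cross3_scaleR_left: "cross3 (c *\<^sub>R x) y = c *\<^sub>R cross3 x y"
  by (simp add: cross3_def vec_eq_iff forall_3 algebra_simps)

text \<open>The factor 2 pi of a circle of period one turns the coefficient A / (4 pi) of a sphere
  of area A into A / 2, the slope of \<open>height\<close>. Since \<open>height\<close> is linear,
  its value at a tangent vector is its derivative there.\<close>

lemma X_gen_form:
  assumes "norm p = 1" "norm q = 1" "p \<bullet> v = 0" "q \<bullet> w = 0"
  shows "form (X_mfd \<alpha>) (p, q) (X_gen a c (p, q)) (v, w)
    = a * height (2 * (\<alpha> + 1)) v + c * height (2 * \<alpha>) w"
  using assms by (simp add: X_mfd_def prod_symp_def S2_def X_gen_def height_def
      cross3_scaleR_left form_rot_gen)

lemma height_has_vector_derivative:
  "(\<gamma> has_vector_derivative v) F \<Longrightarrow> ((\<lambda>t. height a (\<gamma> t)) has_vector_derivative height a v) F"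
proof -
  have "bounded_linear (height a)"
    using bounded_linear_compose [OF bounded_linear_mult_right [of "a / 2"] bounded_linear_vec_nth [of 3]]
    by (simp add: height_def [abs_def])
  then show "(\<gamma> has_vector_derivative v) F \<Longrightarrow> ((\<lambda>t. height a (\<gamma> t)) has_vector_derivative height a v) F"
    by (rule bounded_linear.has_vector_derivative)
qed

text \<open>\<open>f\<close> takes the generator of a model circle action to that of a one-parameter
  subgroup of the torus and preserves the form. Hence, along the curve, the matching combination of
  moment coordinates has the same derivative as \<open>H\<close>.\<close>

lemma chart_moment_along_curve:
  fixes M :: "'a::real_normed_vector symp" and f :: "'a \<Rightarrow> XT" and \<gamma> :: "real \<Rightarrow> 'a"
  assumes emb: "symplectic_embedding M (X_mfd \<alpha>) f"
    and \<gamma>: "\<And>t. t \<in> {0..1} \<Longrightarrow> \<gamma> t \<in> pts M"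
      "\<And>t. t \<in> {0..1} \<Longrightarrow> (\<gamma> has_vector_derivative \<gamma>' t) (at t within {0..1})"
      "\<And>t. t \<in> {0..1} \<Longrightarrow> \<gamma>' t \<in> tang M (\<gamma> t)"
    and flow: "\<And>t r. t \<in> {0..1} \<Longrightarrow> flow r (\<gamma> t) \<in> pts M"
      "\<And>t. flow 0 (\<gamma> t) = \<gamma> t"
      "\<And>t. t \<in> {0..1} \<Longrightarrow> ((\<lambda>r. flow r (\<gamma> t)) has_vector_derivative gen t) (at 0)"
      "\<And>t. t \<in> {0..1} \<Longrightarrow> gen t \<in> tang M (\<gamma> t)"
      "\<And>t r. t \<in> {0..1} \<Longrightarrow> f (flow r (\<gamma> t)) = act_X (a * r) (c * r) (f (\<gamma> t))"
    and H: "\<And>t. t \<in> {0..1} \<Longrightarrow> (H has_vector_derivative form M (\<gamma> t) (gen t) (\<gamma>' t)) (at t within {0..1})"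
  shows "a * fst (\<mu> \<alpha> (f (\<gamma> 1))) + c * snd (\<mu> \<alpha> (f (\<gamma> 1))) - H 1
    = a * fst (\<mu> \<alpha> (f (\<gamma> 0))) + c * snd (\<mu> \<alpha> (f (\<gamma> 0))) - H 0"
proof -
  define G where "G t = a * height (2 * (\<alpha> + 1)) (fst (f (\<gamma> t))) + c * height (2 * \<alpha>) (snd (f (\<gamma> t))) - H t" for t
  have "(G has_vector_derivative 0) (at t within {0..1})" if t: "t \<in> {0..1}" for t
  proof -
    obtain D where D: "(f has_derivative D) (at (\<gamma> t) within pts M)"
      and D_form: "\<And>u v. u \<in> tang M (\<gamma> t) \<Longrightarrow> v \<in> tang M (\<gamma> t) \<Longrightarrow>
        form (X_mfd \<alpha>) (f (\<gamma> t)) (D u) (D v) = form M (\<gamma> t) u v"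
      using emb \<gamma>(1) [OF t] unfolding symplectic_embedding_def by blast
    obtain v w where vw: "D (\<gamma>' t) = (v, w)" by (cases "D (\<gamma>' t)")
    \<comment> \<open>The derivative of \<open>f\<close> is relative to \<open>pts M\<close>, so it
      is restricted to the image of the curve before the chain rule is applied.\<close>
    have "(f has_derivative D) (at (\<gamma> t) within \<gamma> ` {0..1})"
      by (rule has_derivative_subset [OF D]) (use \<gamma>(1) in blast)
    from vector_derivative_diff_chain_within [OF \<gamma>(2) [OF t] this]
    have fd: "((\<lambda>t. f (\<gamma> t)) has_vector_derivative (v, w)) (at t within {0..1})"
      unfolding o_def vw .
    have fd1: "((\<lambda>t. fst (f (\<gamma> t))) has_vector_derivative v) (at t within {0..1})"
      using bounded_linear.has_vector_derivative [OF bounded_linear_fst fd] by simp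
    have fd2: "((\<lambda>t. snd (f (\<gamma> t))) has_vector_derivative w) (at t within {0..1})"
      using bounded_linear.has_vector_derivative [OF bounded_linear_snd fd] by simp
    have "f (\<gamma> r) \<in> pts (X_mfd \<alpha>)" if "r \<in> {0..1}" for r
      using emb \<gamma>(1) [OF that] unfolding symplectic_embedding_def by blast
    then have sph: "norm (fst (f (\<gamma> r))) = 1" "norm (snd (f (\<gamma> r))) = 1" if "r \<in> {0..1}" for r
      using that by (force simp: X_mfd_def prod_symp_def S2_def)+
    obtain p q where pq: "f (\<gamma> t) = (p, q)" by (cases "f (\<gamma> t)")
    have tangent: "p \<bullet> v = 0" "q \<bullet> w = 0"
      using sphere_velocity_tangent [OF fd1 t] sphere_velocity_tangent [OF fd2 t] sph pq by auto
    \<comment> \<open>The image of a flow line is differentiated in two ways, by the chain rule and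
      through equivariance; uniqueness of the velocity identifies \<open>D (gen t)\<close>.\<close>
    have "((\<lambda>r. f (flow r (\<gamma> t))) has_vector_derivative D (gen t)) (at 0)"
    proof -
      have "(f has_derivative D) (at (flow 0 (\<gamma> t)) within range (\<lambda>r. flow r (\<gamma> t)))"
        unfolding flow(2) by (rule has_derivative_subset [OF D]) (use flow(1) [OF t] in blast)
      then show ?thesis
        using vector_derivative_diff_chain_within [OF flow(3) [OF t], of f D] by (simp add: o_def)
    qed
    moreover have "((\<lambda>r. f (flow r (\<gamma> t))) has_vector_derivative X_gen a c (p, q)) (at 0)"
      unfolding flow(5) [OF t] pq by (rule act_X_has_vector_derivative)
    ultimately have "D (gen t) = X_gen a c (p, q)"
      by (rule vector_derivative_unique_at)
    then have "form M (\<gamma> t) (gen t) (\<gamma>' t) = a * height (2 * (\<alpha> + 1)) v + c * height (2 * \<alpha>) w"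
      using D_form [OF flow(4) [OF t] \<gamma>(3) [OF t]] X_gen_form [of p q v w \<alpha> a c] tangent
        sph [OF t] vw pq by simp
    then have "(H has_vector_derivative (a * height (2 * (\<alpha> + 1)) v + c * height (2 * \<alpha>) w)) (at t within {0..1})"
      using H [OF t] by simp
    then have "((\<lambda>t. a * height (2 * (\<alpha> + 1)) (fst (f (\<gamma> t))) + c * height (2 * \<alpha>) (snd (f (\<gamma> t))) - H t)
      has_vector_derivative (a * height (2 * (\<alpha> + 1)) v + c * height (2 * \<alpha>) w
       - (a * height (2 * (\<alpha> + 1)) v + c * height (2 * \<alpha>) w))) (at t within {0..1})"
      by (intro has_vector_derivative_diff has_vector_derivative_add has_vector_derivative_mult_right
          height_has_vector_derivative fd1 fd2)
    then show ?thesis by (simp add: G_def [abs_def])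
  qed
  then have "\<exists>k. \<forall>t\<in>{0..1}. G t = k"
    by (intro has_derivative_zero_constant) (simp_all add: has_vector_derivative_def)
  then have "G 1 = G 0" by fastforce
  then show ?thesis by (simp add: G_def \<mu>_def case_prod_beta)
qed

section \<open>Moment values of charts on the two models\<close>

lemma real_vector_polar:
  fixes x y :: real
  obtains t where "x = sqrt (x\<^sup>2 + y\<^sup>2) * cos (2 * pi * t)" "y = sqrt (x\<^sup>2 + y\<^sup>2) * sin (2 * pi * t)"
proof -
  obtain r a where "Complex x y = rcis r a" "r = cmod (Complex x y)"
    by (metis rcis_Ex rcis_cmod_Arg)
  then show ?thesis
    using that [of "a / (2 * pi)"] by (auto simp: complex_eq_iff cmod_def)
qed

lemma complex_polar:
  obtains t where "z = cis (2 * pi * t) * of_real (cmod z)"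
  using that [of "Arg z / (2 * pi)"] rcis_cmod_Arg [of z] by (simp add: rcis_def mult.commute)

text \<open>A great circle through the poles, with t the latitude.\<close>

definition meridian :: "real \<Rightarrow> real^3" where
  "meridian t = vector [cos t, 0, sin t]"

definition meridian' :: "real \<Rightarrow> real^3" where
  "meridian' t = vector [- sin t, 0, cos t]"

lemma norm_meridian: "norm (meridian t) = 1"
  by (simp add: meridian_def norm_eq_sqrt_inner inner_vec_def sum_3 flip: power2_eq_square)

lemma meridian_inner_meridian': "meridian t \<bullet> meridian' t = 0"
  by (simp add: meridian_def meridian'_def inner_vec_def sum_3)

lemma meridian_has_vector_derivative:
  "((\<lambda>t. meridian (t * c)) has_vector_derivative c *\<^sub>R meridian' (t * c)) (at t within S)"
proof -
  have eq: "meridian t = cos t *\<^sub>R vector [1, 0, 0] + sin t *\<^sub>R vector [0, 0, 1]"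
    "meridian' t = - sin t *\<^sub>R vector [1, 0, 0] + cos t *\<^sub>R vector [0, 0, 1]" for t
    by (simp_all add: meridian_def meridian'_def vec_eq_iff forall_3)
  show ?thesis
    unfolding eq
    by (auto intro!: derivative_eq_intros simp: has_vector_derivative_def scaleR_add_right scaleR_diff_right mult_ac)
qed

lemma norm_rot: "norm (rot t p) = norm p"
proof -
  define c s where "c = cos (2 * pi * t)" and "s = sin (2 * pi * t)"
  have "c\<^sup>2 + s\<^sup>2 = 1" by (simp add: c_def s_def)
  moreover have "rot t p \<bullet> rot t p = (c\<^sup>2 + s\<^sup>2) * ((p $ 1)\<^sup>2 + (p $ 2)\<^sup>2) + (p $ 3)\<^sup>2"
    by (simp add: rot_def inner_vec_def sum_3 flip: c_def s_def)
      (simp add: power2_eq_square algebra_simps)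
  ultimately have "rot t p \<bullet> rot t p = p \<bullet> p"
    by (simp add: inner_vec_def sum_3 power2_eq_square)
  then show ?thesis by (simp add: norm_eq_sqrt_inner)
qed

lemma cis_rotation_has_vector_derivative:
  "((\<lambda>r. cis (2 * pi * r) * w) has_vector_derivative 2 * pi * \<i> * w) (at 0)"
proof -
  have "((\<lambda>r. exp (r *\<^sub>R (2 * pi * \<i>)) * w) has_vector_derivative exp (0 *\<^sub>R (2 * pi * \<i>)) * (2 * pi * \<i>) * w) (at 0)"
    by (intro has_vector_derivative_mult_left exp_scaleR_has_vector_derivative_right)
  then show ?thesis by (simp add: cis_conv_exp scaleR_conv_of_real mult_ac)
qed

text \<open>Spherical coordinates: c is the latitude and 2 pi t the longitude.\<close>

lemma sphere_eq_rot_meridian: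
  fixes z :: "real^3"
  assumes "norm z = 1"
  obtains t c where "z = rot t (meridian c)" "z $ 3 = sin c"
proof -
  have n: "(z $ 1)\<^sup>2 + (z $ 2)\<^sup>2 + (z $ 3)\<^sup>2 = 1"
    using assms by (simp add: norm_eq_sqrt_inner inner_vec_def sum_3 power2_eq_square)
  define c where "c = arcsin (z $ 3)"
  have "(z $ 3)\<^sup>2 \<le> 1" using n by (smt (verit) zero_le_power2)
  then have b: "\<bar>z $ 3\<bar> \<le> 1" by (simp add: abs_square_le_1)
  then have c: "sin c = z $ 3" "cos c = sqrt ((z $ 1)\<^sup>2 + (z $ 2)\<^sup>2)"
    using n by (auto simp: c_def cos_arcsin algebra_simps)
  obtain t where "z $ 1 = sqrt ((z $ 1)\<^sup>2 + (z $ 2)\<^sup>2) * cos (2 * pi * t)"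
    "z $ 2 = sqrt ((z $ 1)\<^sup>2 + (z $ 2)\<^sup>2) * sin (2 * pi * t)"
    using real_vector_polar by blast
  then have "z = rot t (meridian c)"
    using c by (simp add: rot_def meridian_def vec_eq_iff forall_3 mult.commute)
  then show ?thesis using c(1) that by simp
qed

text \<open>By equivariance the moment value of \<open>f m\<close> is constant on torus orbits, so
  it suffices to reach one point of each orbit by a curve. Along it each of the two model circles
  gives one identity; the first involves a and c because these are the speeds of the image of the
  first circle.\<close>

lemma M1_moment:
  assumes emb: "symplectic_embedding (M1 \<alpha>) (X_mfd \<alpha>) f"
    and equi: "equivariant_up_to_aut (pts (M1 \<alpha>)) act_1 act_X f"
  obtains a b c d :: int and k l :: real where "\<bar>a * d - b * c\<bar> = 1"
    "\<And>m. m \<in> pts (M1 \<alpha>) \<Longrightarrow> a * fst (\<mu> \<alpha> (f m)) + c * snd (\<mu> \<alpha> (f m)) = fst (\<nu>1 \<alpha> m) + k"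
    "\<And>m. m \<in> pts (M1 \<alpha>) \<Longrightarrow> b * fst (\<mu> \<alpha> (f m)) + d * snd (\<mu> \<alpha> (f m)) = snd (\<nu>1 \<alpha> m) + l"
proof -
  obtain a b c d :: int where det: "\<bar>a * d - b * c\<bar> = 1"
    and eq: "\<And>s t m. m \<in> pts (M1 \<alpha>) \<Longrightarrow> f (act_1 s t m) =
      act_X (of_int a * s + of_int b * t) (of_int c * s + of_int d * t) (f m)"
    using equi unfolding equivariant_up_to_aut_def by blast
  \<comment> \<open>A point where both model moment coordinates vanish.\<close>
  define m0 :: M1T where "m0 = ((1, 0), meridian 0)"
  have pts: "pts (M1 \<alpha>) = {((w, p), z). norm w = 1 \<and> \<bar>p\<bar> < 1 \<and> norm z = 1}"
    by (auto simp: M1_def prod_symp_def cyl_def S2_def)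
  have tang: "((w', p'), z') \<in> tang (M1 \<alpha>) ((w, p), z) \<longleftrightarrow> w \<bullet> w' = 0 \<and> z \<bullet> z' = 0" for w p z w' p' z'
    by (auto simp: M1_def prod_symp_def cyl_def S2_def)
  have "a * fst (\<mu> \<alpha> (f m)) + c * snd (\<mu> \<alpha> (f m)) - fst (\<nu>1 \<alpha> m)
      = a * fst (\<mu> \<alpha> (f m0)) + c * snd (\<mu> \<alpha> (f m0)) - 0 \<and>
    b * fst (\<mu> \<alpha> (f m)) + d * snd (\<mu> \<alpha> (f m)) - snd (\<nu>1 \<alpha> m)
      = b * fst (\<mu> \<alpha> (f m0)) + d * snd (\<mu> \<alpha> (f m0)) - 0"
    if "m \<in> pts (M1 \<alpha>)" for m
  proof -
    obtain w p z where m: "m = ((w, p), z)" by (metis surj_pair)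
    with that have norms: "norm w = 1" "\<bar>p\<bar> < 1" "norm z = 1" by (auto simp: pts)
    obtain s where s: "w = cis (2 * pi * s)" using complex_polar [of w] norms by auto
    obtain t e where te: "z = rot t (meridian e)" "z $ 3 = sin e"
      using sphere_eq_rot_meridian [OF norms(3)] .
    \<comment> \<open>Leads from \<open>m0\<close> to a torus translate of \<open>m\<close>: p grows
      linearly and z moves along a meridian, both angles being kept.\<close>
    define \<gamma> where "\<gamma> r = ((1 :: complex, r * p), meridian (r * e))" for r
    define \<gamma>' where "\<gamma>' r = ((0 :: complex, p), e *\<^sub>R meridian' (r * e))" for r
    have \<gamma>: "\<gamma> r \<in> pts (M1 \<alpha>)" if "r \<in> {0..1}" for r
    proof -
      have "\<bar>r * p\<bar> \<le> 1 * \<bar>p\<bar>" unfolding abs_mult using that by (intro mult_right_mono) auto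
      then show ?thesis using norms by (auto simp: \<gamma>_def pts norm_meridian)
    qed
    have \<gamma>_deriv: "(\<gamma> has_vector_derivative \<gamma>' r) (at r within {0..1})" for r
      unfolding \<gamma>_def \<gamma>'_def
      by (intro has_vector_derivative_Pair meridian_has_vector_derivative) (auto intro!: derivative_eq_intros simp: has_vector_derivative_def)
    have \<gamma>_tang: "\<gamma>' r \<in> tang (M1 \<alpha>) (\<gamma> r)" for r
      unfolding \<gamma>_def \<gamma>'_def tang by (simp add: meridian_inner_meridian')
    have m_eq: "m = act_1 s t (\<gamma> 1)" by (simp add: m s te act_1_def \<gamma>_def)
    have \<mu>: "\<mu> \<alpha> (f m) = \<mu> \<alpha> (f (\<gamma> 1))" unfolding m_eq using eq \<gamma> by simp
    have m0: "m0 = \<gamma> 0" by (simp add: m0_def \<gamma>_def)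
    have act: "act_1 x y (\<gamma> r) \<in> pts (M1 \<alpha>)" if "r \<in> {0..1}" for x y r
    proof -
      show ?thesis using \<gamma> [OF that] by (auto simp: pts act_1_def \<gamma>_def norm_mult norm_rot)
    qed
    have 1: "a * fst (\<mu> \<alpha> (f (\<gamma> 1))) + c * snd (\<mu> \<alpha> (f (\<gamma> 1))) - 1 * p
      = a * fst (\<mu> \<alpha> (f (\<gamma> 0))) + c * snd (\<mu> \<alpha> (f (\<gamma> 0))) - 0 * p"
    proof (rule chart_moment_along_curve [OF emb \<gamma> \<gamma>_deriv \<gamma>_tang, where flow = "\<lambda>r. act_1 r 0"
          and gen = "\<lambda>t. ((2 * pi * \<i>, 0), 0)"])
      show "((\<lambda>r. act_1 r 0 (\<gamma> t)) has_vector_derivative ((2 * pi * \<i>, 0), 0)) (at 0)" for t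
        using cis_rotation_has_vector_derivative [of 1]
        unfolding act_1_def \<gamma>_def prod.case rot_0
        by (intro has_vector_derivative_Pair has_vector_derivative_const) (simp_all add: mult_ac)
      show "((\<lambda>t. t * p) has_vector_derivative form (M1 \<alpha>) (\<gamma> t) ((2 * pi * \<i>, 0), 0) (\<gamma>' t)) (at t within {0..1})" for t
        by (auto intro!: derivative_eq_intros simp: has_vector_derivative_def M1_def prod_symp_def cyl_def S2_def \<gamma>_def \<gamma>'_def)
      show "((2 * pi * \<i>, 0), 0) \<in> tang (M1 \<alpha>) (\<gamma> t)" for t
        by (simp add: \<gamma>_def tang inner_complex_def)
      show "act_1 r 0 (\<gamma> t) \<in> pts (M1 \<alpha>)" if "t \<in> {0..1}" for t and r :: real
        using act [OF that] .
      show "f (act_1 r 0 (\<gamma> t)) = act_X (a * r) (c * r) (f (\<gamma> t))" if "t \<in> {0..1}" for t and r :: real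
        using eq [OF \<gamma> [OF that], of r 0] by simp
    qed (auto simp: act_1_def \<gamma>_def)
    \<comment> \<open>For the second circle, \<open>H\<close> is the height of the point at latitude
      t e on the sphere of area 2\<alpha>.\<close>
    have 2: "b * fst (\<mu> \<alpha> (f (\<gamma> 1))) + d * snd (\<mu> \<alpha> (f (\<gamma> 1))) - \<alpha> * sin (1 * e)
      = b * fst (\<mu> \<alpha> (f (\<gamma> 0))) + d * snd (\<mu> \<alpha> (f (\<gamma> 0))) - \<alpha> * sin (0 * e)"
    proof (rule chart_moment_along_curve [OF emb \<gamma> \<gamma>_deriv \<gamma>_tang, where flow = "\<lambda>r. act_1 0 r"
          and gen = "\<lambda>t. (0, (2 * pi) *\<^sub>R rot_gen (meridian (t * e)))"])
      show "((\<lambda>r. act_1 0 r (\<gamma> t)) has_vector_derivative (0, (2 * pi) *\<^sub>R rot_gen (meridian (t * e)))) (at 0)" for t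
        using rot_has_vector_derivative [of 1 "meridian (t * e)"]
        unfolding act_1_def \<gamma>_def prod.case
        by (intro has_vector_derivative_Pair has_vector_derivative_const) (simp_all add: zero_prod_def)
      have "form (M1 \<alpha>) (\<gamma> t) (0, (2 * pi) *\<^sub>R rot_gen (meridian (t * e))) (\<gamma>' t) = \<alpha> * (cos (t * e) * e)" for t
        using form_rot_gen [OF norm_meridian, of "t * e" "e *\<^sub>R meridian' (t * e)"]
        by (simp add: M1_def prod_symp_def cyl_def S2_def \<gamma>_def \<gamma>'_def zero_prod_def cross3_scaleR_left
            meridian_inner_meridian') (simp add: meridian'_def)
      then show "((\<lambda>t. \<alpha> * sin (t * e)) has_vector_derivative
          form (M1 \<alpha>) (\<gamma> t) (0, (2 * pi) *\<^sub>R rot_gen (meridian (t * e))) (\<gamma>' t)) (at t within {0..1})" for t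
        by (auto intro!: derivative_eq_intros simp: has_vector_derivative_def)
      show "(0, (2 * pi) *\<^sub>R rot_gen (meridian (t * e))) \<in> tang (M1 \<alpha>) (\<gamma> t)" for t
        by (simp add: \<gamma>_def tang zero_prod_def inner_rot_gen)
      show "act_1 0 r (\<gamma> t) \<in> pts (M1 \<alpha>)" if "t \<in> {0..1}" for t and r :: real
        using act [OF that] .
      show "f (act_1 0 r (\<gamma> t)) = act_X (b * r) (d * r) (f (\<gamma> t))" if "t \<in> {0..1}" for t and r :: real
        using eq [OF \<gamma> [OF that], of 0 r] by simp
    qed (auto simp: act_1_def \<gamma>_def)
    show ?thesis using 1 2 unfolding m0 \<mu> by (simp add: m \<nu>1_def height_def te(2))
  qed
  then show ?thesis
    using that [OF det] by (smt (verit))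
qed

text \<open>The curves are now rays from the centre of the ball. In the sign convention under which
  \<open>height\<close> generates the rotation of a sphere, the form of \<open>M2\<close> makes -pi
  |z|^2 generate the rotation of a plane, hence the minus signs.\<close>

lemma M2_moment:
  assumes emb: "symplectic_embedding (M2 \<alpha>) (X_mfd \<alpha>) f"
    and equi: "equivariant_up_to_aut (pts (M2 \<alpha>)) act_2 act_X f"
  obtains a b c d :: int where "\<bar>a * d - b * c\<bar> = 1"
    "\<And>m. m \<in> pts (M2 \<alpha>) \<Longrightarrow> a * fst (\<mu> \<alpha> (f m)) + c * snd (\<mu> \<alpha> (f m))
      = a * fst (\<mu> \<alpha> (f (0, 0))) + c * snd (\<mu> \<alpha> (f (0, 0))) - fst (\<nu>2 m)"
    "\<And>m. m \<in> pts (M2 \<alpha>) \<Longrightarrow> b * fst (\<mu> \<alpha> (f m)) + d * snd (\<mu> \<alpha> (f m))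
      = b * fst (\<mu> \<alpha> (f (0, 0))) + d * snd (\<mu> \<alpha> (f (0, 0))) - snd (\<nu>2 m)"
proof -
  obtain a b c d :: int where det: "\<bar>a * d - b * c\<bar> = 1"
    and eq: "\<And>s t m. m \<in> pts (M2 \<alpha>) \<Longrightarrow> f (act_2 s t m) =
      act_X (of_int a * s + of_int b * t) (of_int c * s + of_int d * t) (f m)"
    using equi unfolding equivariant_up_to_aut_def by blast
  have pts: "pts (M2 \<alpha>) = {(z1, z2). pi * (cmod z1)\<^sup>2 + pi * (cmod z2)\<^sup>2 < 2 * \<alpha>}"
    and tang: "tang (M2 \<alpha>) x = UNIV" for x
    by (simp_all add: M2_def)
  have "a * fst (\<mu> \<alpha> (f m)) + c * snd (\<mu> \<alpha> (f m)) + fst (\<nu>2 m)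
      = a * fst (\<mu> \<alpha> (f (0, 0))) + c * snd (\<mu> \<alpha> (f (0, 0))) \<and>
    b * fst (\<mu> \<alpha> (f m)) + d * snd (\<mu> \<alpha> (f m)) + snd (\<nu>2 m)
      = b * fst (\<mu> \<alpha> (f (0, 0))) + d * snd (\<mu> \<alpha> (f (0, 0)))"
    if "m \<in> pts (M2 \<alpha>)" for m
  proof -
    obtain z1 z2 where m: "m = (z1, z2)" by (metis surj_pair)
    define r1 r2 where "r1 = cmod z1" and "r2 = cmod z2"
    with that have less: "pi * r1\<^sup>2 + pi * r2\<^sup>2 < 2 * \<alpha>" by (auto simp: pts m)
    obtain s1 where s1: "z1 = cis (2 * pi * s1) * r1" using complex_polar [of z1] r1_def by auto
    obtain s2 where s2: "z2 = cis (2 * pi * s2) * r2" using complex_polar [of z2] r2_def by auto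
    define \<gamma> where "\<gamma> r = (complex_of_real (r * r1), complex_of_real (r * r2))" for r
    define \<gamma>' where "\<gamma>' r = (complex_of_real r1, complex_of_real r2)" for r :: real
    have \<gamma>: "\<gamma> r \<in> pts (M2 \<alpha>)" if "r \<in> {0..1}" for r
    proof -
      have "r\<^sup>2 \<le> 1" using that by (simp add: abs_square_le_1)
      then have "r\<^sup>2 * (pi * r1\<^sup>2 + pi * r2\<^sup>2) \<le> 1 * (pi * r1\<^sup>2 + pi * r2\<^sup>2)"
        by (intro mult_right_mono) auto
      then show ?thesis
        using less by (simp add: \<gamma>_def pts norm_mult power_mult_distrib algebra_simps)
    qed
    have \<gamma>_deriv: "(\<gamma> has_vector_derivative \<gamma>' r) (at r within {0..1})" for r
      unfolding \<gamma>_def \<gamma>'_def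
      by (intro has_vector_derivative_Pair has_vector_derivative_of_real)
        (auto intro!: derivative_eq_intros simp: has_vector_derivative_def)
    have \<gamma>_tang: "\<gamma>' r \<in> tang (M2 \<alpha>) (\<gamma> r)" for r
      by (simp add: tang)
    have "m = act_2 s1 s2 (\<gamma> 1)" by (simp add: m s1 s2 act_2_def \<gamma>_def)
    then have \<mu>: "\<mu> \<alpha> (f m) = \<mu> \<alpha> (f (\<gamma> 1))" using eq \<gamma> by simp
    have m0: "(0, 0) = \<gamma> 0" by (simp add: \<gamma>_def)
    have act: "act_2 x y (\<gamma> r) \<in> pts (M2 \<alpha>)" if "r \<in> {0..1}" for x y r
      using \<gamma> [OF that] by (simp add: pts act_2_def \<gamma>_def norm_mult)
    have 1: "a * fst (\<mu> \<alpha> (f (\<gamma> 1))) + c * snd (\<mu> \<alpha> (f (\<gamma> 1))) - - pi * (1 * r1)\<^sup>2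
      = a * fst (\<mu> \<alpha> (f (\<gamma> 0))) + c * snd (\<mu> \<alpha> (f (\<gamma> 0))) - - pi * (0 * r1)\<^sup>2"
    proof (rule chart_moment_along_curve [OF emb \<gamma> \<gamma>_deriv \<gamma>_tang, where flow = "\<lambda>r. act_2 r 0"
          and gen = "\<lambda>t. (2 * pi * \<i> * of_real (t * r1), 0)"])
      show "((\<lambda>r. act_2 r 0 (\<gamma> t)) has_vector_derivative (2 * pi * \<i> * of_real (t * r1), 0)) (at 0)" for t
        using cis_rotation_has_vector_derivative [of "of_real (t * r1)"]
        unfolding act_2_def \<gamma>_def prod.case
        by (intro has_vector_derivative_Pair has_vector_derivative_const) simp_all
      show "((\<lambda>t. - pi * (t * r1)\<^sup>2) has_vector_derivative
          form (M2 \<alpha>) (\<gamma> t) (2 * pi * \<i> * of_real (t * r1), 0) (\<gamma>' t)) (at t within {0..1})" for t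
        by (auto intro!: derivative_eq_intros simp: has_vector_derivative_def M2_def \<gamma>'_def)
      show "act_2 r 0 (\<gamma> t) \<in> pts (M2 \<alpha>)" if "t \<in> {0..1}" for t and r :: real
        using act [OF that] .
      show "f (act_2 r 0 (\<gamma> t)) = act_X (a * r) (c * r) (f (\<gamma> t))" if "t \<in> {0..1}" for t and r :: real
        using eq [OF \<gamma> [OF that], of r 0] by simp
    qed (auto simp: tang act_2_def \<gamma>_def)
    have 2: "b * fst (\<mu> \<alpha> (f (\<gamma> 1))) + d * snd (\<mu> \<alpha> (f (\<gamma> 1))) - - pi * (1 * r2)\<^sup>2
      = b * fst (\<mu> \<alpha> (f (\<gamma> 0))) + d * snd (\<mu> \<alpha> (f (\<gamma> 0))) - - pi * (0 * r2)\<^sup>2"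
    proof (rule chart_moment_along_curve [OF emb \<gamma> \<gamma>_deriv \<gamma>_tang, where flow = "\<lambda>r. act_2 0 r"
          and gen = "\<lambda>t. (0, 2 * pi * \<i> * of_real (t * r2))"])
      show "((\<lambda>r. act_2 0 r (\<gamma> t)) has_vector_derivative (0, 2 * pi * \<i> * of_real (t * r2))) (at 0)" for t
        using cis_rotation_has_vector_derivative [of "of_real (t * r2)"]
        unfolding act_2_def \<gamma>_def prod.case
        by (intro has_vector_derivative_Pair has_vector_derivative_const) simp_all
      show "((\<lambda>t. - pi * (t * r2)\<^sup>2) has_vector_derivative
          form (M2 \<alpha>) (\<gamma> t) (0, 2 * pi * \<i> * of_real (t * r2)) (\<gamma>' t)) (at t within {0..1})" for t
        by (auto intro!: derivative_eq_intros simp: has_vector_derivative_def M2_def \<gamma>'_def)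
      show "act_2 0 r (\<gamma> t) \<in> pts (M2 \<alpha>)" if "t \<in> {0..1}" for t and r :: real
        using act [OF that] .
      show "f (act_2 0 r (\<gamma> t)) = act_X (b * r) (d * r) (f (\<gamma> t))" if "t \<in> {0..1}" for t and r :: real
        using eq [OF \<gamma> [OF that], of 0 r] by simp
    qed (auto simp: tang act_2_def \<gamma>_def)
    show ?thesis using 1 2 unfolding m0 \<mu> by (simp add: m \<nu>2_def r1_def r2_def)
  qed
  then show ?thesis
    using that [OF det] by (smt (verit))
qed

section \<open>Rigidity of unimodular affine maps\<close>

lemma abs_sum3_less_if_signs:
  fixes x y w c :: real
  assumes "\<bar>x + y + w\<bar> < c" "\<bar>x - y + w\<bar> < c" "\<bar>- x + y + w\<bar> < c" "\<bar>- x - y + w\<bar> < c"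
  shows "\<bar>x\<bar> + \<bar>y\<bar> + \<bar>w\<bar> < c"
  using assms by argo

text \<open>Letting |p| tend to 1 gives |e1| + \<alpha>|e2| + |e0| \<le> 1 and |y1| + \<alpha>|y2| +
  |y0| \<le> \<alpha>. If e1 is nonzero, the first bound kills e2 and e0; then the determinant gives
  |y2| = 1, and the second bound kills y1 and y0.\<close>

lemma unimodular_strip_map:
  fixes e1 e2 y1 y2 :: int and e0 y0 \<alpha> :: real
  assumes "\<alpha> > 0" and det: "\<bar>e1 * y2 - e2 * y1\<bar> = 1"
    and E: "\<And>(p :: real) (h :: real). \<bar>p\<bar> < 1 \<Longrightarrow> \<bar>h\<bar> = \<alpha> \<Longrightarrow> \<bar>e1 * p + e2 * h + e0\<bar> < 1"
    and Y: "\<And>(p :: real) (h :: real). \<bar>p\<bar> < 1 \<Longrightarrow> \<bar>h\<bar> = \<alpha> \<Longrightarrow> \<bar>y1 * p + y2 * h + y0\<bar> \<le> \<alpha>"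
  shows "\<bar>e1\<bar> = 1 \<and> e2 = 0 \<and> e0 = 0 \<and> y1 = 0 \<and> \<bar>y2\<bar> = 1 \<and> y0 = 0"
proof -
  \<comment> \<open>The four sign choices for p and h suffice, since the outer absolute value
    accounts for the overall sign.\<close>
  have E': "z * \<bar>e1\<bar> + \<alpha> * \<bar>e2\<bar> + \<bar>e0\<bar> < 1" if "0 \<le> z" "z < 1" for z :: real
    using abs_sum3_less_if_signs [of "e1 * z" "e2 * \<alpha>" e0 1]
      E [of z \<alpha>] E [of z "- \<alpha>"] E [of "- z" \<alpha>] E [of "- z" "- \<alpha>"] that \<open>\<alpha> > 0\<close>
    by (simp add: abs_mult mult.commute)
  have Y': "z * \<bar>y1\<bar> + \<alpha> * \<bar>y2\<bar> + \<bar>y0\<bar> \<le> \<alpha>" if "0 \<le> z" "z < 1" for z :: real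
  proof (rule field_le_epsilon)
    fix r :: real assume "r > 0"
    then show "z * \<bar>y1\<bar> + \<alpha> * \<bar>y2\<bar> + \<bar>y0\<bar> \<le> \<alpha> + r"
      using abs_sum3_less_if_signs [of "y1 * z" "y2 * \<alpha>" y0 "\<alpha> + r"]
        Y [of z \<alpha>] Y [of z "- \<alpha>"] Y [of "- z" \<alpha>] Y [of "- z" "- \<alpha>"] that \<open>\<alpha> > 0\<close>
      by (simp add: abs_mult mult.commute)
  qed
  have E1: "\<bar>e1\<bar> \<le> 1 - \<alpha> * \<bar>e2\<bar> - \<bar>e0\<bar>"
  proof (rule field_le_mult_one_interval)
    show "z * real_of_int \<bar>e1\<bar> \<le> 1 - \<alpha> * \<bar>e2\<bar> - \<bar>e0\<bar>" if "0 < z" "z < 1" for z :: real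
      using E' [of z] that by linarith
  qed
  have Y1: "\<bar>y1\<bar> \<le> \<alpha> - \<alpha> * \<bar>y2\<bar> - \<bar>y0\<bar>"
  proof (rule field_le_mult_one_interval)
    show "z * real_of_int \<bar>y1\<bar> \<le> \<alpha> - \<alpha> * \<bar>y2\<bar> - \<bar>y0\<bar>" if "0 < z" "z < 1" for z :: real
      using Y' [of z] that by linarith
  qed
  have nonneg: "0 \<le> \<alpha> * \<bar>e2\<bar>" "0 \<le> \<alpha> * \<bar>y2\<bar>" using \<open>\<alpha> > 0\<close> by auto
  have "e1 \<noteq> 0"
  proof
    assume "e1 = 0"
    then have "\<bar>e2\<bar> * \<bar>y1\<bar> = 1" using det by (simp add: abs_mult)
    then have "\<bar>e2\<bar> = 1" "\<bar>y1\<bar> = 1" by (auto simp: zmult_eq_1_iff)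
    then have "real_of_int \<bar>e2\<bar> = 1" "real_of_int \<bar>y1\<bar> = 1" by linarith+
    \<comment> \<open>Taking z = 0 in \<open>E'\<close> keeps the strict bound \<alpha> < 1, while
      \<open>Y1\<close> gives 1 \<le> \<alpha>.\<close>
    then show False using E' [of 0] Y1 nonneg by (simp add: \<open>e1 = 0\<close>)
  qed
  then have "real_of_int \<bar>e1\<bar> \<ge> 1" by linarith
  then have e: "real_of_int \<bar>e1\<bar> = 1" "\<alpha> * \<bar>e2\<bar> = 0" "e0 = 0" using E1 nonneg by linarith+
  then have "\<bar>e1\<bar> = 1" "e2 = 0" using \<open>\<alpha> > 0\<close> by auto
  then have y2: "\<bar>y2\<bar> = 1" using det by (simp add: abs_mult)
  then have "real_of_int \<bar>y2\<bar> = 1" by linarith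
  then have "real_of_int \<bar>y1\<bar> = 0" "y0 = 0" using Y1 by (simp_all)
  then show ?thesis using \<open>\<bar>e1\<bar> = 1\<close> \<open>e2 = 0\<close> e y2 by auto
qed

text \<open>At the two outer vertices the bounds force nonnegative entries and column sums at most
  1. The determinant excludes a zero column, a nonzero column forces b0 = c0 = 0, and only the
  identity and the exchange remain.\<close>

lemma unimodular_corner_map:
  fixes b1 b2 c1 c2 :: int and b0 c0 \<alpha> :: real
  assumes "\<alpha> > 0" and det: "\<bar>b1 * c2 - b2 * c1\<bar> = 1"
    and B: "\<And>(u :: real) (v :: real). 0 \<le> u \<Longrightarrow> 0 \<le> v \<Longrightarrow> u + v < 2 * \<alpha> \<Longrightarrow> 0 \<le> b0 + b1 * u + b2 * v"
    and C: "\<And>(u :: real) (v :: real). 0 \<le> u \<Longrightarrow> 0 \<le> v \<Longrightarrow> u + v < 2 * \<alpha> \<Longrightarrow> 0 \<le> c0 + c1 * u + c2 * v"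
    and BC: "\<And>(u :: real) (v :: real). 0 \<le> u \<Longrightarrow> 0 \<le> v \<Longrightarrow> u + v < 2 * \<alpha> \<Longrightarrow> b0 + b1 * u + b2 * v + (c0 + c1 * u + c2 * v) < 2 * \<alpha>"
  shows "b0 = 0 \<and> c0 = 0 \<and> (b1 = 1 \<and> b2 = 0 \<and> c1 = 0 \<and> c2 = 1 \<or> b1 = 0 \<and> b2 = 1 \<and> c1 = 1 \<and> c2 = 0)"
proof -
  have 0: "0 \<le> b0" "0 \<le> c0" "b0 + c0 < 2 * \<alpha>" using B [of 0 0] C [of 0 0] BC [of 0 0] \<open>\<alpha> > 0\<close> by auto
  \<comment> \<open>The outer vertices do not belong to the triangle, so the bounds there are
    obtained as limits.\<close>
  have edge: "0 \<le> w + k * (2 * \<alpha>)" if "\<And>u. 0 \<le> u \<Longrightarrow> u < 2 * \<alpha> \<Longrightarrow> 0 \<le> w + k * u" for w k :: real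
  proof -
    have "- (k * (2 * \<alpha>)) \<le> w"
    proof (rule field_le_mult_one_interval)
      fix z :: real assume "0 < z" "z < 1"
      then have "0 \<le> w + k * (z * (2 * \<alpha>))" using \<open>\<alpha> > 0\<close> by (intro that) auto
      then show "z * - (k * (2 * \<alpha>)) \<le> w" by (simp add: algebra_simps)
    qed
    then show ?thesis by simp
  qed
  have lim: "0 \<le> b0 + b1 * (2 * \<alpha>)" "0 \<le> c0 + c1 * (2 * \<alpha>)" "0 \<le> b0 + b2 * (2 * \<alpha>)" "0 \<le> c0 + c2 * (2 * \<alpha>)"
    using B [where v = 0] B [where u = 0] C [where v = 0] C [where u = 0] by (auto intro!: edge)
  have "0 \<le> (2 * \<alpha> - b0 - c0) + - real_of_int (b1 + c1) * (2 * \<alpha>)"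
    by (rule edge) (use BC [where v = 0] in \<open>force simp: algebra_simps\<close>)
  then have lim1: "b0 + b1 * (2 * \<alpha>) + (c0 + c1 * (2 * \<alpha>)) \<le> 2 * \<alpha>" by (simp add: algebra_simps)
  have "0 \<le> (2 * \<alpha> - b0 - c0) + - real_of_int (b2 + c2) * (2 * \<alpha>)"
    by (rule edge) (use BC [where u = 0] in \<open>force simp: algebra_simps\<close>)
  then have lim2: "b0 + b2 * (2 * \<alpha>) + (c0 + c2 * (2 * \<alpha>)) \<le> 2 * \<alpha>" by (simp add: algebra_simps)
  \<comment> \<open>An integer k \<le> -1 would outweigh the constant term, which is below
    2\<alpha>.\<close>
  have nonneg: "0 \<le> k" if "0 \<le> r + k * (2 * \<alpha>)" "r < 2 * \<alpha>" for k :: int and r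
  proof (rule ccontr)
    assume "\<not> 0 \<le> k"
    then have "real_of_int k \<le> - 1" by linarith
    then have "k * (2 * \<alpha>) \<le> - 1 * (2 * \<alpha>)" using \<open>\<alpha> > 0\<close> by (intro mult_right_mono) auto
    then show False using that by linarith
  qed
  have sign: "0 \<le> b1" "0 \<le> b2" "0 \<le> c1" "0 \<le> c2"
    using nonneg [OF lim(1)] nonneg [OF lim(2)] nonneg [OF lim(3)] nonneg [OF lim(4)] 0 by linarith+
  \<comment> \<open>Here k and l are the entries of one column. A positive column sum already takes
    up 2\<alpha> and leaves no room for \<open>b0 + c0\<close>.\<close>
  have le1: "k + l \<le> 1" "k + l > 0 \<Longrightarrow> b0 + c0 = 0"
    if "b0 + k * (2 * \<alpha>) + (c0 + l * (2 * \<alpha>)) \<le> 2 * \<alpha>" for k l :: int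
  proof -
    have h: "real_of_int (k + l) * (2 * \<alpha>) \<le> 2 * \<alpha> - (b0 + c0)"
      using that by (simp add: algebra_simps)
    also have "\<dots> \<le> 1 * (2 * \<alpha>)" using 0 by simp
    finally have "real_of_int (k + l) \<le> 1" using \<open>\<alpha> > 0\<close> by (subst (asm) mult_le_cancel_right) auto
    then show "k + l \<le> 1" by linarith
    show "b0 + c0 = 0" if "k + l > 0"
    proof -
      have "1 \<le> real_of_int (k + l)" using that by linarith
      then have "1 * (2 * \<alpha>) \<le> real_of_int (k + l) * (2 * \<alpha>)" using \<open>\<alpha> > 0\<close> by (intro mult_right_mono) auto
      then show ?thesis using h 0 by linarith
    qed
  qed
  have "b1 + c1 > 0"
  proof (rule ccontr)
    assume "\<not> b1 + c1 > 0"
    then have "b1 = 0" "c1 = 0" using sign by auto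
    then show False using det by simp
  qed
  then have "b0 + c0 = 0" using le1(2) [OF lim1] by blast
  then have "b0 = 0" "c0 = 0" using 0 by auto
  have "b1 = 0 \<or> b1 = 1" "c1 = 1 - b1" "b2 = 0 \<or> b2 = 1" "c2 = 0 \<or> c2 = 1" "b2 + c2 \<le> 1"
    using \<open>b1 + c1 > 0\<close> sign le1(1) [OF lim1] le1(1) [OF lim2] by auto
  then show ?thesis using det \<open>b0 = 0\<close> \<open>c0 = 0\<close> by auto
qed

section \<open>Billiard maps on toric fibres\<close>

lemma rect_iff: "(x, y) \<in> rect \<alpha> \<longleftrightarrow> \<bar>x\<bar> \<le> 1 + \<alpha> \<and> \<bar>y\<bar> \<le> \<alpha>"
  by (auto simp: rect_def)

lemma \<mu>_in_rect:
  assumes "\<alpha> > 0" "m \<in> pts (X_mfd \<alpha>)"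
  shows "\<mu> \<alpha> m \<in> rect \<alpha>"
proof -
  obtain p q where m: "m = (p, q)" by (cases m)
  with assms have "norm p = 1" "norm q = 1" by (auto simp: X_mfd_def prod_symp_def S2_def)
  then have "\<bar>p $ 3\<bar> \<le> 1" "\<bar>q $ 3\<bar> \<le> 1" using component_le_norm_cart by metis+
  then have "\<bar>(1 + \<alpha>) * p $ 3\<bar> \<le> (1 + \<alpha>) * 1" "\<bar>\<alpha> * q $ 3\<bar> \<le> \<alpha> * 1"
    unfolding abs_mult using assms by (intro mult_mono; simp)+
  then show ?thesis by (simp add: m \<mu>_def height_def rect_iff algebra_simps)
qed

lemma pts_M1: "pts (M1 \<alpha>) = {((w, p), z). norm w = 1 \<and> \<bar>p\<bar> < 1 \<and> norm z = 1}"
  by (auto simp: M1_def prod_symp_def cyl_def S2_def)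

lemma pts_M2: "pts (M2 \<alpha>) = {(z1, z2). pi * (cmod z1)\<^sup>2 + pi * (cmod z2)\<^sup>2 < 2 * \<alpha>}"
  by (simp add: M2_def)

lemma strip_region_iff:
  assumes "i = 1 \<or> i = 4"
  shows "q \<in> region \<alpha> \<delta> i \<longleftrightarrow> q \<in> rect \<alpha> \<and> \<bar>covec i q\<bar> \<le> 1 - \<delta>"
  using assms by (cases q) (auto simp: region_def covec_def)

text \<open>Widening by \<delta> turns the bound 1 - \<delta> into a strip independent of \<delta>,
  which matches the interval of p in the model.\<close>

lemma strip_region_nbhd:
  assumes "i = 1 \<or> i = 4" "q \<in> region_nbhd \<alpha> \<delta> i"
  shows "q \<in> rect \<alpha>" "\<bar>covec i q\<bar> < 1"
  using assms(2) strip_region_iff [OF assms(1)] unfolding region_nbhd_def by force+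

text \<open>The corner of the rectangle in the triangle \<open>region \<alpha> \<delta> i\<close> is
  \<open>(sgn_x i * (1 + \<alpha>), sgn_y i * \<alpha>)\<close>.\<close>

definition sgn_x :: "nat \<Rightarrow> real" where
  "sgn_x i = (if i = 2 \<or> i = 3 then 1 else - 1)"

definition sgn_y :: "nat \<Rightarrow> real" where
  "sgn_y i = (if i = 2 \<or> i = 5 then 1 else - 1)"

lemma sgn_xy_cases:
  "sgn_x i = 1 \<or> sgn_x i = - 1" "sgn_y i = 1 \<or> sgn_y i = - 1"
  by (auto simp: sgn_x_def sgn_y_def)

lemma corner_region_iff:
  assumes "i \<in> {2, 3, 5, 6}"
  shows "(x, y) \<in> region \<alpha> \<delta> i \<longleftrightarrow> (x, y) \<in> rect \<alpha> \<and> 1 + \<delta> \<le> sgn_x i * x + sgn_y i * y"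
  using assms by (auto simp: region_def sgn_x_def sgn_y_def)

lemma corner_region_nbhd:
  assumes i: "i \<in> {2, 3, 5, 6}" and "(x, y) \<in> region_nbhd \<alpha> \<delta> i"
  shows "(x, y) \<in> rect \<alpha>" "1 < sgn_x i * x + sgn_y i * y"
proof -
  obtain x' y' where r: "(x', y') \<in> region \<alpha> \<delta> i" "\<bar>covec i (x, y) - covec i (x', y')\<bar> < \<delta>"
    using assms(2) unfolding region_nbhd_def by auto
  then have "1 + \<delta> \<le> sgn_x i * x' + sgn_y i * y'" using corner_region_iff [OF i] by blast
  then show "1 < sgn_x i * x + sgn_y i * y"
    using r(2) i by (auto simp: covec_def sgn_x_def sgn_y_def)
  show "(x, y) \<in> rect \<alpha>" using assms(2) unfolding region_nbhd_def by auto
qed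

lemma region_subset_nbhd: "\<delta> > 0 \<Longrightarrow> region \<alpha> \<delta> i \<subseteq> region_nbhd \<alpha> \<delta> i"
  by (force simp: region_nbhd_def region_def)

text \<open>Inverting the integral matrix of the chart writes \<open>covec i\<close> and y as
  integral affine functions of the model coordinates. As their values stay in the open strip and in
  the rectangle, \<open>unimodular_strip_map\<close> leaves only signs.\<close>

lemma strip_chart:
  assumes "\<alpha> > 0" and i: "i = 1 \<or> i = 4"
    and chart: "is_chart \<alpha> \<delta> i (M1 \<alpha>) act_1 \<nu> V f"
  obtains e :: int and y :: int where "\<bar>e\<bar> = 1" "\<bar>y\<bar> = 1"
    "\<And>m. m \<in> pts (M1 \<alpha>) \<Longrightarrow> covec i (\<mu> \<alpha> (f m)) = e * fst (\<nu>1 \<alpha> m)"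
    "\<And>m. m \<in> pts (M1 \<alpha>) \<Longrightarrow> snd (\<mu> \<alpha> (f m)) = y * snd (\<nu>1 \<alpha> m)"
proof -
  define \<sigma> :: int where "\<sigma> = (if odd i then - 1 else 1)"
  have covec: "covec i q = \<sigma> * fst q + snd q" for q :: "real \<times> real"
    by (cases q) (simp add: covec_def \<sigma>_def)
  have emb: "symplectic_embedding (M1 \<alpha>) (X_mfd \<alpha>) f"
    and equi: "equivariant_up_to_aut (pts (M1 \<alpha>)) act_1 act_X f"
    using chart unfolding is_chart_def by blast+
  obtain a b c d :: int and k l :: real where det: "\<bar>a * d - b * c\<bar> = 1"
    and ac: "\<And>m. m \<in> pts (M1 \<alpha>) \<Longrightarrow> a * fst (\<mu> \<alpha> (f m)) + c * snd (\<mu> \<alpha> (f m)) = fst (\<nu>1 \<alpha> m) + k"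
    and bd: "\<And>m. m \<in> pts (M1 \<alpha>) \<Longrightarrow> b * fst (\<mu> \<alpha> (f m)) + d * snd (\<mu> \<alpha> (f m)) = snd (\<nu>1 \<alpha> m) + l"
    by (rule M1_moment [OF emb equi]) (rule that)
  \<comment> \<open>A determinant of 1 or -1 is its own inverse, so Cramer's rule needs no
    division.\<close>
  define D where "D = a * d - b * c"
  have D: "D * D = 1" using det by (metis D_def abs_mult_self_eq mult_1)
  have D': "real_of_int D * real_of_int D = 1" using D by (metis of_int_1 of_int_mult)
  have X: "fst (\<mu> \<alpha> (f m)) = D * d * fst (\<nu>1 \<alpha> m) + - D * c * snd (\<nu>1 \<alpha> m) + D * (d * k - c * l)"
    and Y: "snd (\<mu> \<alpha> (f m)) = - D * b * fst (\<nu>1 \<alpha> m) + D * a * snd (\<nu>1 \<alpha> m) + D * (a * l - b * k)"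
    if "m \<in> pts (M1 \<alpha>)" for m
  proof -
    have "D * (d * (fst (\<nu>1 \<alpha> m) + k) - c * (snd (\<nu>1 \<alpha> m) + l)) = D * D * fst (\<mu> \<alpha> (f m))"
      "D * (a * (snd (\<nu>1 \<alpha> m) + l) - b * (fst (\<nu>1 \<alpha> m) + k)) = D * D * snd (\<mu> \<alpha> (f m))"
      unfolding ac [OF that, symmetric] bd [OF that, symmetric]
      by (simp_all add: D_def algebra_simps)
    then show "fst (\<mu> \<alpha> (f m)) = D * d * fst (\<nu>1 \<alpha> m) + - D * c * snd (\<nu>1 \<alpha> m) + D * (d * k - c * l)"
      "snd (\<mu> \<alpha> (f m)) = - D * b * fst (\<nu>1 \<alpha> m) + D * a * snd (\<nu>1 \<alpha> m) + D * (a * l - b * k)"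
      using D' by (simp_all add: algebra_simps)
  qed
  define e1 e2 e0 where "e1 = \<sigma> * D * d - D * b" and "e2 = D * a - \<sigma> * D * c"
    and "e0 = \<sigma> * (D * (d * k - c * l)) + D * (a * l - b * k)"
  have E: "covec i (\<mu> \<alpha> (f m)) = e1 * fst (\<nu>1 \<alpha> m) + e2 * snd (\<nu>1 \<alpha> m) + e0"
    if "m \<in> pts (M1 \<alpha>)" for m
    unfolding covec X [OF that] Y [OF that] e1_def e2_def e0_def by (simp add: algebra_simps)
  have nbhd: "\<mu> \<alpha> (f m) \<in> region_nbhd \<alpha> \<delta> i" if "m \<in> pts (M1 \<alpha>)" for m
    using chart that unfolding is_chart_def by blast
  \<comment> \<open>The poles of the sphere suffice, as only extreme heights enter
    \<open>unimodular_strip_map\<close>.\<close>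
  have point: "\<exists>m \<in> pts (M1 \<alpha>). \<nu>1 \<alpha> m = (p, h)" if "\<bar>p\<bar> < 1" "\<bar>h\<bar> = \<alpha>" for p h
  proof -
    have "norm (vector [0, 0, h / \<alpha>] :: real^3) = 1"
      using that \<open>\<alpha> > 0\<close> by (simp add: norm_eq_sqrt_inner inner_vec_def sum_3 power2_eq_square [symmetric])
    then show ?thesis using that \<open>\<alpha> > 0\<close>
      by (intro bexI [of _ "((1, p), vector [0, 0, h / \<alpha>])"]) (auto simp: pts_M1 \<nu>1_def height_def)
  qed
  have "\<bar>e1\<bar> = 1 \<and> e2 = 0 \<and> e0 = 0 \<and> - D * b = 0 \<and> \<bar>D * a\<bar> = 1 \<and> D * (a * l - b * k) = 0"
  proof (rule unimodular_strip_map [OF \<open>\<alpha> > 0\<close>])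
    have "e1 * (D * a) - e2 * (- D * b) = (D * D) * \<sigma> * D"
      unfolding e1_def e2_def by (simp add: D_def algebra_simps)
    then show "\<bar>e1 * (D * a) - e2 * (- D * b)\<bar> = 1"
      using D det by (simp add: abs_mult D_def \<sigma>_def)
    show "\<bar>e1 * p + e2 * h + e0\<bar> < 1" if "\<bar>p\<bar> < 1" "\<bar>h\<bar> = \<alpha>" for p h :: real
      using point [OF that] E nbhd strip_region_nbhd(2) [OF i] by (metis fst_conv snd_conv)
    show "\<bar>real_of_int (- D * b) * p + real_of_int (D * a) * h + D * (a * l - b * k)\<bar> \<le> \<alpha>"
      if "\<bar>p\<bar> < 1" "\<bar>h\<bar> = \<alpha>" for p h :: real
    proof -
      from point [OF that] obtain m where m: "m \<in> pts (M1 \<alpha>)" "\<nu>1 \<alpha> m = (p, h)" by blast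
      have "\<mu> \<alpha> (f m) \<in> rect \<alpha>" using strip_region_nbhd(1) [OF i] nbhd m by blast
      then have "\<bar>snd (\<mu> \<alpha> (f m))\<bar> \<le> \<alpha>" by (metis rect_iff prod.collapse)
      then show ?thesis unfolding Y [OF m(1)] m(2) by simp
    qed
  qed
  then have e: "\<bar>e1\<bar> = 1" "e2 = 0" "e0 = 0" and a: "\<bar>D * a\<bar> = 1"
    and zero: "- D * b = 0" "D * (a * l - b * k) = 0"
    by auto
  show ?thesis
  proof (rule that [OF e(1) a])
    fix m assume m: "m \<in> pts (M1 \<alpha>)"
    show "covec i (\<mu> \<alpha> (f m)) = e1 * fst (\<nu>1 \<alpha> m)"
      unfolding E [OF m] by (simp add: e)
    show "snd (\<mu> \<alpha> (f m)) = (D * a) * snd (\<nu>1 \<alpha> m)"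
      unfolding Y [OF m] zero by simp
  qed
qed

text \<open>The left-hand components are the distances to the two sides meeting at the corner. They
  are nonnegative with sum below 2\<alpha>, so they are the model coordinates in one of the two
  orders.\<close>

lemma corner_chart:
  assumes "\<alpha> > 0" and i: "i \<in> {2, 3, 5, 6}"
    and chart: "is_chart \<alpha> \<delta> i (M2 \<alpha>) act_2 \<nu> V f"
  shows "(\<forall>m \<in> pts (M2 \<alpha>). (1 + \<alpha> - sgn_x i * fst (\<mu> \<alpha> (f m)), \<alpha> - sgn_y i * snd (\<mu> \<alpha> (f m))) = \<nu>2 m)
    \<or> (\<forall>m \<in> pts (M2 \<alpha>). (\<alpha> - sgn_y i * snd (\<mu> \<alpha> (f m)), 1 + \<alpha> - sgn_x i * fst (\<mu> \<alpha> (f m))) = \<nu>2 m)"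
proof -
  obtain \<sigma> \<tau> :: int where st: "sgn_x i = \<sigma>" "sgn_y i = \<tau>" "\<bar>\<sigma>\<bar> = 1" "\<bar>\<tau>\<bar> = 1"
    using that [of 1 1] that [of 1 "- 1"] that [of "- 1" 1] that [of "- 1" "- 1"] sgn_xy_cases [of i] by auto
  have emb: "symplectic_embedding (M2 \<alpha>) (X_mfd \<alpha>) f"
    and equi: "equivariant_up_to_aut (pts (M2 \<alpha>)) act_2 act_X f"
    using chart unfolding is_chart_def by blast+
  obtain a b c d :: int where det: "\<bar>a * d - b * c\<bar> = 1"
    and ac: "\<And>m. m \<in> pts (M2 \<alpha>) \<Longrightarrow> a * fst (\<mu> \<alpha> (f m)) + c * snd (\<mu> \<alpha> (f m))
      = a * fst (\<mu> \<alpha> (f (0, 0))) + c * snd (\<mu> \<alpha> (f (0, 0))) - fst (\<nu>2 m)"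
    and bd: "\<And>m. m \<in> pts (M2 \<alpha>) \<Longrightarrow> b * fst (\<mu> \<alpha> (f m)) + d * snd (\<mu> \<alpha> (f m))
      = b * fst (\<mu> \<alpha> (f (0, 0))) + d * snd (\<mu> \<alpha> (f (0, 0))) - snd (\<nu>2 m)"
    by (rule M2_moment [OF emb equi]) (rule that)
  define D where "D = a * d - b * c"
  define X0 Y0 where "X0 = fst (\<mu> \<alpha> (f (0, 0)))" and "Y0 = snd (\<mu> \<alpha> (f (0, 0)))"
  have D: "D * D = 1" using det by (metis D_def abs_mult_self_eq mult_1)
  have D': "real_of_int D * real_of_int D = 1" using D by (metis of_int_1 of_int_mult)
  \<comment> \<open>The distances of the image of the centre of the ball from the two sides; they
    turn out to vanish, so the centre goes to the corner.\<close>
  define b0 c0 where "b0 = 1 + \<alpha> - \<sigma> * X0" and "c0 = \<alpha> - \<tau> * Y0"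
  have X: "1 + \<alpha> - \<sigma> * fst (\<mu> \<alpha> (f m)) = b0 + (\<sigma> * D * d) * fst (\<nu>2 m) + (- \<sigma> * D * c) * snd (\<nu>2 m)"
    and Y: "\<alpha> - \<tau> * snd (\<mu> \<alpha> (f m)) = c0 + (- \<tau> * D * b) * fst (\<nu>2 m) + (\<tau> * D * a) * snd (\<nu>2 m)"
    if "m \<in> pts (M2 \<alpha>)" for m
  proof -
    have uv: "fst (\<nu>2 m) = a * (X0 - fst (\<mu> \<alpha> (f m))) + c * (Y0 - snd (\<mu> \<alpha> (f m)))"
      "snd (\<nu>2 m) = b * (X0 - fst (\<mu> \<alpha> (f m))) + d * (Y0 - snd (\<mu> \<alpha> (f m)))"
      using ac [OF that] bd [OF that] by (simp_all add: X0_def Y0_def algebra_simps)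
    have "b0 + (\<sigma> * D * d) * fst (\<nu>2 m) + (- \<sigma> * D * c) * snd (\<nu>2 m)
        = b0 + D * D * (\<sigma> * (X0 - fst (\<mu> \<alpha> (f m))))"
      "c0 + (- \<tau> * D * b) * fst (\<nu>2 m) + (\<tau> * D * a) * snd (\<nu>2 m)
        = c0 + D * D * (\<tau> * (Y0 - snd (\<mu> \<alpha> (f m))))"
      unfolding uv by (simp_all add: D_def algebra_simps)
    then show "1 + \<alpha> - \<sigma> * fst (\<mu> \<alpha> (f m)) = b0 + (\<sigma> * D * d) * fst (\<nu>2 m) + (- \<sigma> * D * c) * snd (\<nu>2 m)"
      "\<alpha> - \<tau> * snd (\<mu> \<alpha> (f m)) = c0 + (- \<tau> * D * b) * fst (\<nu>2 m) + (\<tau> * D * a) * snd (\<nu>2 m)"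
      using D' by (simp_all add: b0_def c0_def algebra_simps)
  qed
  have bounds: "0 \<le> 1 + \<alpha> - \<sigma> * fst (\<mu> \<alpha> (f m))" "0 \<le> \<alpha> - \<tau> * snd (\<mu> \<alpha> (f m))"
    "1 + \<alpha> - \<sigma> * fst (\<mu> \<alpha> (f m)) + (\<alpha> - \<tau> * snd (\<mu> \<alpha> (f m))) < 2 * \<alpha>" if "m \<in> pts (M2 \<alpha>)" for m
  proof -
    obtain x y where xy: "\<mu> \<alpha> (f m) = (x, y)" by (cases "\<mu> \<alpha> (f m)")
    have "(x, y) \<in> region_nbhd \<alpha> \<delta> i" using chart that xy unfolding is_chart_def by force
    then have "\<bar>x\<bar> \<le> 1 + \<alpha>" "\<bar>y\<bar> \<le> \<alpha>" "1 < \<sigma> * x + \<tau> * y"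
      using corner_region_nbhd [OF i] st by (simp_all add: rect_iff)
    then show "0 \<le> 1 + \<alpha> - \<sigma> * fst (\<mu> \<alpha> (f m))" "0 \<le> \<alpha> - \<tau> * snd (\<mu> \<alpha> (f m))"
      "1 + \<alpha> - \<sigma> * fst (\<mu> \<alpha> (f m)) + (\<alpha> - \<tau> * snd (\<mu> \<alpha> (f m))) < 2 * \<alpha>"
      using st(3,4) unfolding xy by (auto simp: abs_if split: if_splits)
  qed
  have point: "\<exists>m \<in> pts (M2 \<alpha>). \<nu>2 m = (u, v)" if "0 \<le> u" "0 \<le> v" "u + v < 2 * \<alpha>" for u v
    using that
    by (intro bexI [of _ "(of_real (sqrt (u / pi)), of_real (sqrt (v / pi)))"]) (auto simp: pts_M2 \<nu>2_def)
  have "b0 = 0 \<and> c0 = 0 \<and> (\<sigma> * D * d = 1 \<and> - \<sigma> * D * c = 0 \<and> - \<tau> * D * b = 0 \<and> \<tau> * D * a = 1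
    \<or> \<sigma> * D * d = 0 \<and> - \<sigma> * D * c = 1 \<and> - \<tau> * D * b = 1 \<and> \<tau> * D * a = 0)"
  proof (rule unimodular_corner_map [OF \<open>\<alpha> > 0\<close>])
    have "\<sigma> * D * d * (\<tau> * D * a) - - \<sigma> * D * c * (- \<tau> * D * b) = \<sigma> * \<tau> * (D * D) * D"
      by (simp add: D_def algebra_simps)
    then show "\<bar>\<sigma> * D * d * (\<tau> * D * a) - - \<sigma> * D * c * (- \<tau> * D * b)\<bar> = 1"
      using D det st by (simp add: abs_mult D_def)
    fix u v :: real assume "0 \<le> u" "0 \<le> v" "u + v < 2 * \<alpha>"
    then obtain m where m: "m \<in> pts (M2 \<alpha>)" "\<nu>2 m = (u, v)" using point by blast
    show "0 \<le> b0 + real_of_int (\<sigma> * D * d) * u + real_of_int (- \<sigma> * D * c) * v"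
      using bounds(1) [OF m(1)] X [OF m(1)] m(2) by simp
    show "0 \<le> c0 + real_of_int (- \<tau> * D * b) * u + real_of_int (\<tau> * D * a) * v"
      using bounds(2) [OF m(1)] Y [OF m(1)] m(2) by simp
    show "b0 + real_of_int (\<sigma> * D * d) * u + real_of_int (- \<sigma> * D * c) * v
      + (c0 + real_of_int (- \<tau> * D * b) * u + real_of_int (\<tau> * D * a) * v) < 2 * \<alpha>"
      using bounds(3) [OF m(1)] X [OF m(1)] Y [OF m(1)] m(2) by simp
  qed
  then consider (same) "b0 = 0" "c0 = 0" "\<sigma> * D * d = 1" "- \<sigma> * D * c = 0" "- \<tau> * D * b = 0" "\<tau> * D * a = 1"
    | (swap) "b0 = 0" "c0 = 0" "\<sigma> * D * d = 0" "- \<sigma> * D * c = 1" "- \<tau> * D * b = 1" "\<tau> * D * a = 0"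
    by blast
  then show ?thesis
  proof cases
    case same
    show ?thesis
      unfolding st
    proof (intro disjI1 ballI)
      fix m assume m: "m \<in> pts (M2 \<alpha>)"
      show "(1 + \<alpha> - \<sigma> * fst (\<mu> \<alpha> (f m)), \<alpha> - \<tau> * snd (\<mu> \<alpha> (f m))) = \<nu>2 m"
        unfolding X [OF m] Y [OF m] same by (simp add: prod_eq_iff)
    qed
  next
    case swap
    show ?thesis
      unfolding st
    proof (intro disjI2 ballI)
      fix m assume m: "m \<in> pts (M2 \<alpha>)"
      show "(\<alpha> - \<tau> * snd (\<mu> \<alpha> (f m)), 1 + \<alpha> - \<sigma> * fst (\<mu> \<alpha> (f m))) = \<nu>2 m"
        unfolding X [OF m] Y [OF m] swap by (simp add: prod_eq_iff)
    qed
  qed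
qed

section \<open>The six factors on moment values\<close>

lemma transport_region:
  assumes "\<delta> > 0" and chart: "is_chart \<alpha> \<delta> i M act \<nu> V f"
    and "x \<in> pts (X_mfd \<alpha>)" "\<mu> \<alpha> x \<in> region \<alpha> \<delta> i"
  obtains m where "m \<in> pts M" "f m = x" "transport (pts M) f chi x = f (chi m)"
proof -
  have "x \<in> f ` pts M"
    using assms region_subset_nbhd unfolding is_chart_def by blast
  moreover have "inj_on f (pts M)"
    using chart unfolding is_chart_def symplectic_embedding_def homeomorphism_def
    by (metis inj_on_inverseI)
  ultimately show ?thesis
    using that by (auto simp: transport_def the_inv_into_f_f)
qed

lemma transport_outside:
  assumes "is_chart \<alpha> \<delta> i M act \<nu> V f" "\<mu> \<alpha> x \<notin> region_nbhd \<alpha> \<delta> i"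
  shows "transport (pts M) f chi x = x"
  using assms unfolding is_chart_def transport_def by auto

text \<open>In the model, \<open>R\<close> keeps p and negates the height. The unknown signs of the
  chart are the same before and after and cancel.\<close>

lemma transport_strip:
  assumes "\<alpha> > 0" "\<delta> > 0" and i: "i = 1 \<or> i = 4"
    and chart: "is_chart \<alpha> \<delta> i (M1 \<alpha>) act_1 (\<nu>1 \<alpha>) (V1 \<alpha> \<delta>) f"
    and chi: "is_chi1 \<alpha> \<delta> R chi"
    and R: "\<And>z. norm z = 1 \<Longrightarrow> norm (R z) = 1 \<and> height (2 * \<alpha>) (R z) = - height (2 * \<alpha>) z"
    and x: "x \<in> pts (X_mfd \<alpha>)" and inside: "\<bar>covec i (\<mu> \<alpha> x)\<bar> < 1 - \<delta>"
  shows "transport (pts (M1 \<alpha>)) f chi x \<in> pts (X_mfd \<alpha>)"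
    and "covec i (\<mu> \<alpha> (transport (pts (M1 \<alpha>)) f chi x)) = covec i (\<mu> \<alpha> x)"
    and "snd (\<mu> \<alpha> (transport (pts (M1 \<alpha>)) f chi x)) = - snd (\<mu> \<alpha> x)"
proof -
  have "\<mu> \<alpha> x \<in> region \<alpha> \<delta> i"
    using strip_region_iff [OF i] \<mu>_in_rect [OF \<open>\<alpha> > 0\<close> x] inside by simp
  then obtain m where m: "m \<in> pts (M1 \<alpha>)" "f m = x" and
    t: "transport (pts (M1 \<alpha>)) f chi x = f (chi m)"
    using transport_region [OF \<open>\<delta> > 0\<close> chart x] by blast
  obtain e y :: int where ey: "\<bar>e\<bar> = 1" "\<bar>y\<bar> = 1"
    and e: "\<And>m. m \<in> pts (M1 \<alpha>) \<Longrightarrow> covec i (\<mu> \<alpha> (f m)) = e * fst (\<nu>1 \<alpha> m)"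
    and y: "\<And>m. m \<in> pts (M1 \<alpha>) \<Longrightarrow> snd (\<mu> \<alpha> (f m)) = y * snd (\<nu>1 \<alpha> m)"
    by (rule strip_chart [OF \<open>\<alpha> > 0\<close> i chart]) (rule that)
  obtain w p z where m_eq: "m = ((w, p), z)" by (metis surj_pair)
  have "real_of_int \<bar>e\<bar> = 1" using ey by simp
  \<comment> \<open>As |e| = 1, the bound on the covector is a bound on p and places
    \<open>m\<close> where \<open>chi\<close> acts exactly by \<open>R\<close>.\<close>
  then have "\<bar>p\<bar> < 1 - \<delta>" using inside e [OF m(1)] m by (simp add: m_eq \<nu>1_def abs_mult)
  then have chi_m: "chi m = ((w, p), R z)"
    using chi m(1) unfolding is_chi1_def m_eq by auto
  have z: "norm z = 1" using m(1) by (simp add: m_eq pts_M1)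
  then have chi_pts: "chi m \<in> pts (M1 \<alpha>)" using m(1) R by (simp add: chi_m [unfolded m_eq] m_eq pts_M1)
  then show "transport (pts (M1 \<alpha>)) f chi x \<in> pts (X_mfd \<alpha>)"
    unfolding t using chart unfolding is_chart_def by blast
  show "covec i (\<mu> \<alpha> (transport (pts (M1 \<alpha>)) f chi x)) = covec i (\<mu> \<alpha> x)"
    unfolding t using e [OF chi_pts] e [OF m(1)] m by (simp add: chi_m [unfolded m_eq] m_eq \<nu>1_def)
  show "snd (\<mu> \<alpha> (transport (pts (M1 \<alpha>)) f chi x)) = - snd (\<mu> \<alpha> x)"
    unfolding t using y [OF chi_pts] y [OF m(1)] m R [OF z] by (simp add: chi_m [unfolded m_eq] m_eq \<nu>1_def)
qed

text \<open>Exchanging the coordinates of the ball exchanges the distances to the two sides, in both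
  alternatives of \<open>corner_chart\<close>.\<close>

lemma transport_corner:
  assumes "\<alpha> > 0" "\<delta> > 0" and i: "i \<in> {2, 3, 5, 6}"
    and chart: "is_chart \<alpha> \<delta> i (M2 \<alpha>) act_2 \<nu>2 (V2 \<alpha> \<delta>) f"
    and chi: "is_chi2 \<alpha> \<delta> chi"
    and x: "x \<in> pts (X_mfd \<alpha>)" and \<mu>: "\<mu> \<alpha> x = (a, b)" and inside: "1 + \<delta> \<le> sgn_x i * a + sgn_y i * b"
  shows "transport (pts (M2 \<alpha>)) f chi x \<in> pts (X_mfd \<alpha>)"
    and "\<mu> \<alpha> (transport (pts (M2 \<alpha>)) f chi x) = (sgn_x i * (1 + sgn_y i * b), sgn_y i * (sgn_x i * a - 1))"
proof -
  have "\<mu> \<alpha> x \<in> region \<alpha> \<delta> i"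
    unfolding \<mu> corner_region_iff [OF i] using \<mu>_in_rect [OF \<open>\<alpha> > 0\<close> x] inside \<mu> by simp
  then obtain m where m: "m \<in> pts (M2 \<alpha>)" "f m = x" and
    t: "transport (pts (M2 \<alpha>)) f chi x = f (chi m)"
    using transport_region [OF \<open>\<delta> > 0\<close> chart x] by blast
  obtain z1 z2 where m_eq: "m = (z1, z2)" by (cases m)
  note c = corner_chart [OF \<open>\<alpha> > 0\<close> i chart]
  \<comment> \<open>The sum does not depend on the order of the coordinates; it places
    \<open>m\<close> where \<open>chi\<close> is exactly the swap.\<close>
  have "fst (\<nu>2 m) + snd (\<nu>2 m) = 1 + 2 * \<alpha> - (sgn_x i * a + sgn_y i * b)"
    using c
  proof
    assume "\<forall>m \<in> pts (M2 \<alpha>). (1 + \<alpha> - sgn_x i * fst (\<mu> \<alpha> (f m)), \<alpha> - sgn_y i * snd (\<mu> \<alpha> (f m))) = \<nu>2 m"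
    from bspec [OF this m(1), symmetric] show ?thesis unfolding m(2) \<mu> by simp
  next
    assume "\<forall>m \<in> pts (M2 \<alpha>). (\<alpha> - sgn_y i * snd (\<mu> \<alpha> (f m)), 1 + \<alpha> - sgn_x i * fst (\<mu> \<alpha> (f m))) = \<nu>2 m"
    from bspec [OF this m(1), symmetric] show ?thesis unfolding m(2) \<mu> by simp
  qed
  then have "pi * (cmod z1)\<^sup>2 + pi * (cmod z2)\<^sup>2 \<le> 2 * \<alpha> - \<delta>"
    using inside by (simp add: m_eq \<nu>2_def)
  then have chi_m: "chi m = (z2, z1)"
    using chi unfolding is_chi2_def m_eq by blast
  have chi_pts: "chi m \<in> pts (M2 \<alpha>)" using m(1) by (simp add: chi_m [unfolded m_eq] m_eq pts_M2 add.commute)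
  then show "transport (pts (M2 \<alpha>)) f chi x \<in> pts (X_mfd \<alpha>)"
    unfolding t using chart unfolding is_chart_def by blast
  have swap: "\<nu>2 (chi m) = prod.swap (\<nu>2 m)" by (simp add: chi_m [unfolded m_eq] m_eq \<nu>2_def)
  have "1 + \<alpha> - sgn_x i * fst (\<mu> \<alpha> (f (chi m))) = \<alpha> - sgn_y i * b \<and>
    \<alpha> - sgn_y i * snd (\<mu> \<alpha> (f (chi m))) = 1 + \<alpha> - sgn_x i * a"
    using c
  proof
    assume "\<forall>m \<in> pts (M2 \<alpha>). (1 + \<alpha> - sgn_x i * fst (\<mu> \<alpha> (f m)), \<alpha> - sgn_y i * snd (\<mu> \<alpha> (f m))) = \<nu>2 m"
    from bspec [OF this chi_pts] bspec [OF this m(1), symmetric] show ?thesis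
      unfolding swap m(2) \<mu> by simp
  next
    assume "\<forall>m \<in> pts (M2 \<alpha>). (\<alpha> - sgn_y i * snd (\<mu> \<alpha> (f m)), 1 + \<alpha> - sgn_x i * fst (\<mu> \<alpha> (f m))) = \<nu>2 m"
    from bspec [OF this chi_pts] bspec [OF this m(1), symmetric] show ?thesis
      unfolding swap m(2) \<mu> by simp
  qed
  then show "\<mu> \<alpha> (transport (pts (M2 \<alpha>)) f chi x) = (sgn_x i * (1 + sgn_y i * b), sgn_y i * (sgn_x i * a - 1))"
    unfolding t using sgn_xy_cases [of i] by (auto simp: prod_eq_iff)
qed

text \<open>Ties only the base point to \<open>x\<close>: the tangent vector lives in the abstract
  dynamics, and no derivative of a billiard map is taken.\<close>

definition over :: "real \<Rightarrow> XT \<Rightarrow> tvec \<Rightarrow> bool" where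
  "over \<alpha> x = (\<lambda>(d, s, u, v). x \<in> pts (X_mfd \<alpha>) \<and>
     fst (\<mu> \<alpha> x) - snd (\<mu> \<alpha> x) = d \<and> fst (\<mu> \<alpha> x) + snd (\<mu> \<alpha> x) = s)"

lemma over_step_strip:
  assumes "\<alpha> > 0" "\<delta> > 0" and i: "i = 1 \<or> i = 4"
    and chart: "is_chart \<alpha> \<delta> i (M1 \<alpha>) act_1 (\<nu>1 \<alpha>) (V1 \<alpha> \<delta>) f"
    and chi: "is_chi1 \<alpha> \<delta> R chi"
    and R: "\<And>z. norm z = 1 \<Longrightarrow> norm (R z) = 1 \<and> height (2 * \<alpha>) (R z) = - height (2 * \<alpha>) z"
    and z: "off_walls \<delta> z" "over \<alpha> x z"
  shows "over \<alpha> (transport (pts (M1 \<alpha>)) f chi x) (step i z)"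
proof -
  obtain d s u v where z_eq: "z = (d, s, u, v)" by (cases z)
  obtain a b where ab: "\<mu> \<alpha> x = (a, b)" by (cases "\<mu> \<alpha> x")
  have x: "x \<in> pts (X_mfd \<alpha>)" and d: "d = a - b" and s: "s = a + b"
    using z(2) by (auto simp: z_eq over_def ab)
  define c where "c = (if i = 1 then d else s)"
  have c: "\<bar>covec i (\<mu> \<alpha> x)\<bar> = \<bar>c\<bar>" using i by (auto simp: ab covec_def c_def d s)
  have "\<bar>\<bar>c\<bar> - 1\<bar> > \<delta>" using z(1) by (simp add: z_eq off_walls_def c_def)
  \<comment> \<open>The range 1 - \<delta> \<le> |c| < 1, where the cut-off acts, is excluded by
    \<open>off_walls\<close>; from |c| = 1 on, the point is outside the image of the chart.\<close>
  then consider "\<bar>c\<bar> < 1 - \<delta>" | "\<bar>c\<bar> \<ge> 1" by linarith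
  then show ?thesis
  proof cases
    case 1
    define y where "y = transport (pts (M1 \<alpha>)) f chi x"
    have y: "y \<in> pts (X_mfd \<alpha>)" "covec i (\<mu> \<alpha> y) = covec i (\<mu> \<alpha> x)" "snd (\<mu> \<alpha> y) = - snd (\<mu> \<alpha> x)"
      unfolding y_def using transport_strip [OF assms(1,2) i chart chi R x] 1 c by auto
    obtain a' b' where ab': "\<mu> \<alpha> y = (a', b')" by (cases "\<mu> \<alpha> y")
    have "over \<alpha> y (step i z)"
      using i 1 y \<open>\<delta> > 0\<close> unfolding z_eq d s ab ab'
      by (auto simp: over_def step_def covec_def c_def d s ab')
    then show ?thesis by (simp add: y_def)
  next
    case 2
    then have "\<mu> \<alpha> x \<notin> region_nbhd \<alpha> \<delta> i" using strip_region_nbhd(2) [OF i] c by fastforce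
    then have "transport (pts (M1 \<alpha>)) f chi x = x" by (rule transport_outside [OF chart])
    moreover have "step i z = z" using i 2 by (auto simp: z_eq step_def c_def)
    ultimately show ?thesis using z by simp
  qed
qed

lemma over_step_corner:
  assumes "\<alpha> > 0" "\<delta> > 0" and i: "i \<in> {2, 3, 5, 6}"
    and chart: "is_chart \<alpha> \<delta> i (M2 \<alpha>) act_2 \<nu>2 (V2 \<alpha> \<delta>) f"
    and chi: "is_chi2 \<alpha> \<delta> chi"
    and z: "off_walls \<delta> z" "over \<alpha> x z"
  shows "over \<alpha> (transport (pts (M2 \<alpha>)) f chi x) (step i z)"
proof -
  obtain d s u v where z_eq: "z = (d, s, u, v)" by (cases z)
  obtain a b where ab: "\<mu> \<alpha> x = (a, b)" by (cases "\<mu> \<alpha> x")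
  have x: "x \<in> pts (X_mfd \<alpha>)" and d: "d = a - b" and s: "s = a + b"
    using z(2) by (auto simp: z_eq over_def ab)
  define c where "c = sgn_x i * a + sgn_y i * b"
  have c: "c = (if i = 2 then s else if i = 3 then d else if i = 5 then - d else - s)"
    using i by (auto simp: c_def d s sgn_x_def sgn_y_def)
  have "\<bar>\<bar>c\<bar> - 1\<bar> > \<delta>" using z(1) by (simp add: z_eq off_walls_def c)
  then consider "c \<ge> 1 + \<delta>" | "c \<le> 1" by linarith
  then show ?thesis
  proof cases
    case 1
    define y where "y = transport (pts (M2 \<alpha>)) f chi x"
    have y: "y \<in> pts (X_mfd \<alpha>)" "\<mu> \<alpha> y = (sgn_x i * (1 + sgn_y i * b), sgn_y i * (sgn_x i * a - 1))"
      unfolding y_def using transport_corner [OF assms(1,2) i chart chi x ab] 1 c_def by auto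
    have "over \<alpha> y (step i z)"
      using i 1 \<open>\<delta> > 0\<close> unfolding over_def z_eq c
      by (auto simp: y step_def sgn_x_def sgn_y_def d s)
    then show ?thesis by (simp add: y_def)
  next
    case 2
    then have "\<mu> \<alpha> x \<notin> region_nbhd \<alpha> \<delta> i"
      using corner_region_nbhd(2) [OF i] ab c_def by fastforce
    then have "transport (pts (M2 \<alpha>)) f chi x = x" by (rule transport_outside [OF chart])
    moreover have "step i z = z" using i 2 by (auto simp: z_eq step_def c)
    ultimately show ?thesis using z by simp
  qed
qed

section \<open>The billiard map and its iterates\<close>

lemma Ham_maps_pts:
  assumes "\<phi> \<in> Ham M" "x \<in> pts M"
  shows "\<phi> x \<in> pts M"
proof -
  obtain \<Phi> :: "real \<Rightarrow> 'a \<Rightarrow> 'a" where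
    "\<And>x. x \<in> pts M \<Longrightarrow> \<Phi> 1 x = \<phi> x \<and> (\<forall>t\<in>{0..1}. \<Phi> t x \<in> pts M)"
    using assms(1) unfolding Ham_def by blast
  then show ?thesis using assms(2) by (metis atLeastAtMost_iff order_refl zero_le_one)
qed

lemma over_billiard:
  assumes "\<alpha> > 0" "\<delta> > 0" and billiard: "billiard_map \<alpha> \<delta> \<psi>"
    and walls: "\<And>j. j < 6 \<Longrightarrow> off_walls \<delta> (run (6 * k + j) z)" and x: "over \<alpha> x (run (6 * k) z)"
  shows "over \<alpha> (\<psi> x) (run (6 * Suc k) z)"
proof -
  obtain R chi1 chi2 and f :: "nat \<Rightarrow> M1T \<Rightarrow> XT" and g :: "nat \<Rightarrow> M2T \<Rightarrow> XT" where
    "R \<in> Ham (S2 (2 * \<alpha>))"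
    and R': "\<forall>z\<in>pts (S2 (2 * \<alpha>)). height (2 * \<alpha>) (R z) = - height (2 * \<alpha>) z"
    and chi: "is_chi1 \<alpha> \<delta> R chi1" "is_chi2 \<alpha> \<delta> chi2"
    and f: "\<forall>i\<in>{1, 4}. is_chart \<alpha> \<delta> i (M1 \<alpha>) act_1 (\<nu>1 \<alpha>) (V1 \<alpha> \<delta>) (f i)"
    and g: "\<forall>i\<in>{2, 3, 5, 6}. is_chart \<alpha> \<delta> i (M2 \<alpha>) act_2 \<nu>2 (V2 \<alpha> \<delta>) (g i)"
    and \<psi>: "\<forall>x\<in>pts (X_mfd \<alpha>). \<psi> x =
           (transport (pts (M2 \<alpha>)) (g 6) chi2 \<circ> transport (pts (M2 \<alpha>)) (g 5) chi2 \<circ>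
            transport (pts (M1 \<alpha>)) (f 4) chi1 \<circ> transport (pts (M2 \<alpha>)) (g 3) chi2 \<circ>
            transport (pts (M2 \<alpha>)) (g 2) chi2 \<circ> transport (pts (M1 \<alpha>)) (f 1) chi1) x"
    using billiard unfolding billiard_map_def by blast
  have R: "norm (R z) = 1 \<and> height (2 * \<alpha>) (R z) = - height (2 * \<alpha>) z" if "norm z = 1" for z
    using Ham_maps_pts [OF \<open>R \<in> Ham (S2 (2 * \<alpha>))\<close>, of z] R' that by (simp add: S2_def)
  define \<phi> where "\<phi> i = (if i = 1 \<or> i = 4 then transport (pts (M1 \<alpha>)) (f i) chi1
    else transport (pts (M2 \<alpha>)) (g i) chi2)" for i
  have \<phi>: "over \<alpha> (\<phi> i y) (run (6 * k + i) z)"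
    if "over \<alpha> y (run (6 * k + j) z)" "i = j + 1" "j < 6" for i j y
  proof (cases "i = 1 \<or> i = 4")
    case True
    then show ?thesis
      using over_step_strip [OF assms(1,2) True _ chi(1) R walls [OF \<open>j < 6\<close>] that(1)] f
      unfolding run_step [OF that(2,3)] by (auto simp: \<phi>_def)
  next
    case False
    then have i: "i \<in> {2, 3, 5, 6}" using that by auto
    then show ?thesis
      using over_step_corner [OF assms(1,2) i _ chi(2) walls [OF \<open>j < 6\<close>] that(1)] g False
      unfolding run_step [OF that(2,3)] by (auto simp: \<phi>_def)
  qed
  have "\<psi> x = \<phi> 6 (\<phi> 5 (\<phi> 4 (\<phi> 3 (\<phi> 2 (\<phi> 1 x)))))"
    using \<psi> x by (auto simp: \<phi>_def over_def split: prod.splits)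
  moreover have "over \<alpha> (\<phi> 6 (\<phi> 5 (\<phi> 4 (\<phi> 3 (\<phi> 2 (\<phi> 1 x)))))) (run (6 * k + 6) z)"
    by (rule \<phi> [of _ 5], rule \<phi> [of _ 4], rule \<phi> [of _ 3], rule \<phi> [of _ 2], rule \<phi> [of _ 1], rule \<phi> [of _ 0])
      (use x in simp_all)
  moreover have "6 * Suc k = 6 * k + 6" by simp
  ultimately show ?thesis by metis
qed

text \<open>\<open>run\<close> counts single factors, six to a round, so that
  \<open>off_walls\<close> covers every intermediate position and not only the ends of
  rounds.\<close>

lemma over_billiard_funpow:
  assumes "\<alpha> > 0" "\<delta> > 0" and "billiard_map \<alpha> \<delta> \<psi>"
    and "\<And>n. n < 6 * k \<Longrightarrow> off_walls \<delta> (run n z)" and "over \<alpha> x z"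
  shows "over \<alpha> ((\<psi> ^^ k) x) (run (6 * k) z)"
  using assms(4)
proof (induction k)
  case 0
  then show ?case using assms by simp
next
  case (Suc k)
  then show ?case using over_billiard [OF assms(1-3), of k z] by simp
qed

lemma torus_eq: "torus \<alpha> q = {m \<in> pts (X_mfd \<alpha>). \<mu> \<alpha> m = q}"
  by (cases q) (auto simp: torus_def circ_def X_mfd_def prod_symp_def S2_def \<mu>_def)

text \<open>A torus meeting its k-th image would give a run with the same \<open>d\<close> and
  \<open>s\<close> after k rounds, which \<open>no_return\<close> excludes.\<close>

lemma billiard_displaces_torus:
  assumes "\<alpha> > 0" "\<delta> > 0" and billiard: "billiard_map \<alpha> \<delta> \<psi>"
    and q: "(x, y) \<in> interior (rect \<alpha>)" and ind: "independent_over_int (x - y) (x + y)"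
    and walls: "\<And>n. n < 6 * N \<Longrightarrow> off_walls \<delta> (run n (start_vec (x - y, x + y)))"
  shows "(x, y) \<in> \<T> \<alpha> \<psi> N"
proof -
  have "(\<psi> ^^ k) m \<notin> torus \<alpha> (x, y)" if k: "k \<in> {1..N}" and m: "m \<in> torus \<alpha> (x, y)" for k m
  proof
    assume "(\<psi> ^^ k) m \<in> torus \<alpha> (x, y)"
    then have ret: "\<mu> \<alpha> ((\<psi> ^^ k) m) = (x, y)" by (simp add: torus_eq)
    have "over \<alpha> m (start_vec (x - y, x + y))"
      using m by (auto simp: over_def start_vec_def torus_eq)
    then have "over \<alpha> ((\<psi> ^^ k) m) (run (6 * k) (start_vec (x - y, x + y)))"
      using over_billiard_funpow [OF assms(1,2) billiard] walls k by simp
    moreover obtain d s w where "run (6 * k) (start_vec (x - y, x + y)) = (d, s, w)"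
      by (metis prod.exhaust)
    ultimately show False
      using no_return [OF ind, of k] k ret by (cases w) (auto simp: over_def)
  qed
  then show ?thesis using q unfolding \<T>_def by blast
qed

section \<open>Measure of the displaced tori\<close>

lemma smooth_map_continuous:
  assumes "smooth_map S f"
  shows "continuous_on S f"
proof (clarsimp simp: continuous_on_eq_continuous_within)
  fix x assume "x \<in> S"
  then obtain U g where U: "open U" "x \<in> U" "\<forall>k. C_k_on k U g" "\<forall>y\<in>U \<inter> S. g y = f y"
    using assms unfolding smooth_map_def by blast
  then have "continuous_on U g" by (metis C_k_on.simps(1))
  then have "continuous (at x within S) g"
    using U continuous_on_eq_continuous_at continuous_at_imp_continuous_at_within by blast
  moreover have "\<forall>\<^sub>F y in at x within S. g y = f y"
    using U eventually_at_topological by blast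
  ultimately show "continuous (at x within S) f"
    using U(2,4) \<open>x \<in> S\<close> by (metis Int_iff continuous_within Lim_transform_eventually)
qed

lemma Ham_continuous:
  assumes "\<phi> \<in> Ham M"
  shows "continuous_on (pts M) \<phi>"
proof -
  obtain \<Phi> :: "real \<Rightarrow> 'a \<Rightarrow> 'a" where \<Phi>: "smooth_map ({0..1} \<times> pts M) (\<lambda>(t, x). \<Phi> t x)"
    "\<And>x. x \<in> pts M \<Longrightarrow> \<Phi> 1 x = \<phi> x"
    using assms unfolding Ham_def by blast
  have "continuous_on (pts M) (\<lambda>x. (\<lambda>(t, x). \<Phi> t x) (1, x))"
    by (rule continuous_on_compose2 [OF smooth_map_continuous [OF \<Phi>(1)]]) (auto intro!: continuous_intros)
  then show ?thesis using \<Phi>(2) by (simp cong: continuous_on_cong)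
qed

lemma Ham_funpow:
  assumes "\<phi> \<in> Ham M"
  shows "continuous_on (pts M) (\<phi> ^^ k)" "\<And>x. x \<in> pts M \<Longrightarrow> (\<phi> ^^ k) x \<in> pts M"
proof -
  show maps: "(\<phi> ^^ k) x \<in> pts M" if "x \<in> pts M" for x k
    by (induction k) (auto simp: that Ham_maps_pts [OF assms])
  show "continuous_on (pts M) (\<phi> ^^ k)"
  proof (induction k)
    case 0
    then show ?case by (simp add: id_def)
  next
    case (Suc k)
    show ?case
      using continuous_on_compose2 [OF Ham_continuous [OF assms] Suc] maps by (auto simp: o_def)
  qed
qed

text \<open>A torus meets its k-th image exactly when its base point is a moment value on
  \<open>K k\<close>, the compact set of points whose moment value is unchanged by the k-th iterate.
  Openness later supplies measurability.\<close>

lemma open_\<T>: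
  assumes "\<phi> \<in> Ham (X_mfd \<alpha>)"
  shows "open (\<T> \<alpha> \<phi> N)"
proof -
  let ?X = "pts (X_mfd \<alpha>)"
  have X: "?X = sphere 0 1 \<times> sphere 0 1" by (simp add: X_mfd_def prod_symp_def S2_def)
  then have "compact ?X" by (simp add: compact_Times)
  have \<mu>: "continuous_on S (\<mu> \<alpha>)" for S
    unfolding \<mu>_def height_def case_prod_beta by (intro continuous_intros) auto
  define K where "K k = ?X \<inter> (\<lambda>m. \<mu> \<alpha> ((\<phi> ^^ k) m) - \<mu> \<alpha> m) -` {0}" for k
  have "continuous_on ?X (\<lambda>m. \<mu> \<alpha> ((\<phi> ^^ k) m))" for k
    by (rule continuous_on_compose2 [OF \<mu> [of ?X] Ham_funpow(1) [OF assms]]) (auto simp: Ham_funpow(2) [OF assms])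
  then have "closed (K k)" for k
    unfolding K_def using \<open>compact ?X\<close> \<mu>
    by (intro continuous_closed_preimage continuous_on_diff) (auto simp: compact_imp_closed)
  then have "compact (?X \<inter> K k)" for k
    using \<open>compact ?X\<close> by (rule compact_Int_closed [rotated])
  moreover have "?X \<inter> K k = K k" for k
    by (auto simp: K_def)
  ultimately have "compact (K k)" for k
    by simp
  then have "compact (\<mu> \<alpha> ` K k)" for k
    using \<mu> compact_continuous_image by blast
  then have "closed (\<Union>k\<in>{1..N}. \<mu> \<alpha> ` K k)"
    by (intro closed_UN) (auto simp: compact_imp_closed)
  moreover have "\<T> \<alpha> \<phi> N = interior (rect \<alpha>) - (\<Union>k\<in>{1..N}. \<mu> \<alpha> ` K k)"
  proof -
    have K_iff: "m \<in> K k \<longleftrightarrow> m \<in> ?X \<and> \<mu> \<alpha> ((\<phi> ^^ k) m) = \<mu> \<alpha> m" for m k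
      by (simp add: K_def)
    have "(\<phi> ^^ k) ` torus \<alpha> q \<inter> torus \<alpha> q = {} \<longleftrightarrow> q \<notin> \<mu> \<alpha> ` K k" for k q
    proof
      assume "(\<phi> ^^ k) ` torus \<alpha> q \<inter> torus \<alpha> q = {}"
      moreover have "m \<in> torus \<alpha> q" "(\<phi> ^^ k) m \<in> torus \<alpha> q" if "m \<in> K k" "q = \<mu> \<alpha> m" for m
        using that Ham_funpow(2) [OF assms, of m k] by (simp_all add: K_iff torus_eq)
      ultimately show "q \<notin> \<mu> \<alpha> ` K k" by blast
    next
      assume q: "q \<notin> \<mu> \<alpha> ` K k"
      have "m \<in> K k" "q = \<mu> \<alpha> m" if "m \<in> torus \<alpha> q" "(\<phi> ^^ k) m \<in> torus \<alpha> q" for m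
        using that by (simp_all add: K_iff torus_eq)
      with q show "(\<phi> ^^ k) ` torus \<alpha> q \<inter> torus \<alpha> q = {}" by blast
    qed
    then show ?thesis by (auto simp: \<T>_def)
  qed
  ultimately show ?thesis by (simp add: open_Diff)
qed

text \<open>For fixed integers a relation is satisfied on a line with normal vector (m + n, n - m),
  nonzero unless m = n = 0, or nowhere. Lines are null and there are countably many
  relations.\<close>

lemma AE_independent_over_int: "AE q in lebesgue. independent_over_int (fst q - snd q) (fst q + snd q)"
proof -
  have "AE q :: real \<times> real in lebesgue. (m, n) \<noteq> (0, 0) \<longrightarrow>
      of_int m * (fst q - snd q) + of_int n * (fst q + snd q) + of_int l \<noteq> 0" for m n l :: int
  proof (cases "(m, n) = (0, 0)")
    case False
    then have "(real_of_int (m + n), real_of_int (n - m)) \<noteq> 0" by (auto simp: zero_prod_def)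
    then have "negligible {q. (real_of_int (m + n), real_of_int (n - m)) \<bullet> q = - real_of_int l}"
      by (intro negligible_hyperplane) auto
    then have "AE q in lebesgue. q \<notin> {q. (real_of_int (m + n), real_of_int (n - m)) \<bullet> q = - real_of_int l}"
      unfolding negligible_iff_null_sets by (rule AE_not_in)
    then show ?thesis
      by (rule AE_mp) (auto intro!: AE_I2 simp: inner_prod_def algebra_simps)
  qed simp
  then have "AE q :: real \<times> real in lebesgue. \<forall>m n l :: int. (m, n) \<noteq> (0, 0) \<longrightarrow>
      of_int m * (fst q - snd q) + of_int n * (fst q + snd q) + of_int l \<noteq> 0"
    unfolding AE_all_countable by blast
  then show ?thesis
    by (rule AE_mp) (auto intro!: AE_I2 simp: independent_over_int_def)
qed

text \<open>There are finitely many positions, each at positive distance from the walls.\<close>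

lemma eventually_off_walls:
  assumes "independent_over_int d s"
  shows "\<forall>\<^sub>F \<delta> in at_right 0. \<forall>n<m. off_walls \<delta> (run n (start_vec (d, s)))"
proof -
  have "\<forall>\<^sub>F \<delta> in at_right 0. off_walls \<delta> (run n (start_vec (d, s)))" for n
  proof -
    obtain u v where "start_vec (d, s) = (d, s, u, v)" by (cases "d < - 1") (auto simp: start_vec_def)
    then have "tracks (d, s) (u, v) (run n (start_vec (d, s)))"
      using tracks_run [OF tracks_start] by metis
    then have "off_walls 0 (run n (start_vec (d, s)))" by (rule tracks_off_walls [OF assms])
    moreover obtain d' s' w where r: "run n (start_vec (d, s)) = (d', s', w)" by (metis prod.exhaust)
    ultimately have "0 < min (\<bar>\<bar>d'\<bar> - 1\<bar>) (\<bar>\<bar>s'\<bar> - 1\<bar>)" by (cases w) (simp add: off_walls_def)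
    from eventually_at_right_less [of 0] order_tendstoD(2) [OF tendsto_ident_at this, of "{0<..}"]
    show ?thesis
      by eventually_elim (cases w; simp add: r off_walls_def)
  qed
  then have "\<forall>\<^sub>F \<delta> in at_right 0. \<forall>n\<in>{..<m}. off_walls \<delta> (run n (start_vec (d, s)))"
    by (intro eventually_ball_finite) auto
  then show ?thesis by (simp add: Ball_def)
qed

theorem theorem1p19:
  fixes \<alpha> \<delta>0 :: real and \<psi> :: "real \<Rightarrow> XT \<Rightarrow> XT"
  assumes "\<alpha> > 0"
    and "\<delta>0 > 0"
    and "\<And>\<delta>. 0 < \<delta> \<Longrightarrow> \<delta> < \<delta>0 \<Longrightarrow> \<psi> \<delta> \<in> Ham (X_mfd \<alpha>) \<and> billiard_map \<alpha> \<delta> (\<psi> \<delta>)"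
  shows "\<forall>\<epsilon>>0. \<forall>N::nat. \<exists>\<delta>. 0 < \<delta> \<and> \<delta> < \<delta>0 \<and> measure (lam \<alpha>) (\<T> \<alpha> (\<psi> \<delta>) N) > 1 - \<epsilon>"
proof (intro allI impI)
  fix \<epsilon> :: real and N :: nat
  assume "\<epsilon> > 0"
  have rect_cbox: "rect \<alpha> = cbox (- 1 - \<alpha>, - \<alpha>) (1 + \<alpha>, \<alpha>)"
    by (auto simp: rect_def cbox_Pair_eq)
  have "emeasure lebesgue (rect \<alpha>) \<noteq> 0" "emeasure lebesgue (rect \<alpha>) \<noteq> \<infinity>"
    using \<open>\<alpha> > 0\<close> unfolding rect_cbox emeasure_lborel_cbox_eq
    by (auto simp: emeasure_lborel_cbox_eq Basis_prod_def prod.union_disjoint)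
  then interpret prob_space "lam \<alpha>"
    unfolding lam_def by (rule prob_space_uniform_measure)
  \<comment> \<open>A sequence tending to 0; the summand 2 keeps even \<open>D 0\<close> strictly
    below \<open>\<delta>0\<close>.\<close>
  define D where "D j = \<delta>0 / (real j + 2)" for j
  have D: "0 < D j" "D j < \<delta>0" for j
    using \<open>\<delta>0 > 0\<close> by (auto simp: D_def field_simps intro!: add_pos_nonneg)
  have "D \<longlonglongrightarrow> 0"
    using LIMSEQ_ignore_initial_segment [OF lim_const_over_n [of \<delta>0], of 2] by (simp add: D_def [abs_def] add.commute)
  then have D_right: "filterlim D (at_right 0) sequentially"
    using D(1) by (auto simp: filterlim_at less_imp_neq [THEN not_sym] less_imp_le intro!: always_eventually)
  \<comment> \<open>The suitable \<delta> depends on the torus. These sets increase with j and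
    exhaust almost all of the rectangle, so continuity of the measure yields one j that serves for
    all but a small set of tori.\<close>
  define A where "A j = (\<Inter>i\<in>{j..}. \<T> \<alpha> (\<psi> (D i)) N)" for j
  have \<T>_sets: "\<T> \<alpha> (\<psi> (D i)) N \<in> sets (lam \<alpha>)" for i
    using assms(3) [OF D] by (simp add: lam_def open_\<T> lebesgue_openin)
  then have A_sets: "A j \<in> sets (lam \<alpha>)" for j
    unfolding A_def by (intro sets.countable_INT') auto
  \<comment> \<open>The frontier of a convex set is null, so almost every point of the rectangle is
    interior.\<close>
  have "AE q in lebesgue. q \<notin> frontier (rect \<alpha>)"
    unfolding rect_cbox
    by (intro AE_not_in) (simp add: negligible_convex_frontier convex_box flip: negligible_iff_null_sets)
  with AE_independent_over_int have "AE q in lebesgue. q \<in> rect \<alpha> \<longrightarrow> q \<in> (\<Union>j. A j)"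
  proof eventually_elim
    case (elim q)
    show ?case
    proof
      assume "q \<in> rect \<alpha>"
      obtain x y where q: "q = (x, y)" by (cases q)
      have int: "(x, y) \<in> interior (rect \<alpha>)"
        using elim(2) \<open>q \<in> rect \<alpha>\<close> closure_subset unfolding frontier_def q by blast
      have ind: "independent_over_int (x - y) (x + y)" using elim(1) by (simp add: q)
      have "\<forall>\<^sub>F j in sequentially. \<forall>n<6 * N. off_walls (D j) (run n (start_vec (x - y, x + y)))"
        using eventually_off_walls [OF ind] D_right by (rule eventually_compose_filterlim)
      then obtain j where "\<And>i n. i \<ge> j \<Longrightarrow> n < 6 * N \<Longrightarrow> off_walls (D i) (run n (start_vec (x - y, x + y)))"
        unfolding eventually_sequentially by blast
      then have "(x, y) \<in> \<T> \<alpha> (\<psi> (D i)) N" if "i \<ge> j" for i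
        using billiard_displaces_torus [OF \<open>\<alpha> > 0\<close> D(1) _ int ind] assms(3) [OF D] that by blast
      then show "q \<in> (\<Union>j. A j)" by (auto simp: A_def q)
    qed
  qed
  then have "AE q in lam \<alpha>. q \<in> (\<Union>j. A j)"
    unfolding lam_def by (intro AE_uniform_measureI) (simp_all add: rect_cbox)
  then have "prob (\<Union>j. A j) = 1"
    using A_sets by (intro prob_eq_1 [THEN iffD2]) auto
  moreover have "(\<lambda>j. prob (A j)) \<longlonglongrightarrow> prob (\<Union>j. A j)"
    using A_sets by (intro finite_Lim_measure_incseq) (auto simp: incseq_def A_def)
  ultimately have "\<forall>\<^sub>F j in sequentially. prob (A j) > 1 - \<epsilon>"
    using \<open>\<epsilon> > 0\<close> by (intro order_tendstoD) auto
  then obtain j where "prob (A j) > 1 - \<epsilon>"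
    by (meson eventually_happens trivial_limit_sequentially)
  moreover have "prob (A j) \<le> prob (\<T> \<alpha> (\<psi> (D j)) N)"
    using \<T>_sets by (intro finite_measure_mono) (auto simp: A_def)
  ultimately show "\<exists>\<delta>. 0 < \<delta> \<and> \<delta> < \<delta>0 \<and> prob (\<T> \<alpha> (\<psi> \<delta>) N) > 1 - \<epsilon>"
    using D by (meson less_le_trans)
qed

end
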